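(* Let $\Gamma$ be a type environment and $r,s$ terms. Suppose that $\Gamma\vdash r=s$ is valid in every nominal model $\mathcal I$ of the simply-typed $\lambda$-calculus, i.e. for every such $\mathcal I$ there is a type $\phi$ with $\Gamma\vdash r:\phi$, $\Gamma\vdash s:\phi$, and $[\![r]\!]^{\mathcal I}_\Gamma=[\![s]\!]^{\mathcal I}_\Gamma\in\mathcal I_\Gamma(\phi)$. Then $r=_\beta s$.
   Context: Atoms and nominal sets: fix a countably infinite set $\mathbb A$ of atoms; permutations are bijections of $\mathbb A$ moving finitely many atoms, acting on ZFA sets by $\pi\cdot a=\pi(a)$, $\pi\cdot X=\{\pi\cdot x\mid x\in X\}$; $\mathrm{supp}(x)$ is the least finite set $A$ such that every permutation fixing $A$ pointwise fixes $x$; $a\#x$ means $a\notin\mathrm{supp}(x)$. Syntax: simple types $\phi::=\tau\mid\phi\to\phi$ over a nonempty set of base types; constants $C$ with types $\mathrm{type}(C)$; terms $r::=a\mid C\mid\lambda a{:}\phi.r\mid rr$ up to $\alpha$-equivalence; $r[a:=t]$ capture-avoiding substitution. $=_\beta$ is the least equivalence relation on terms closed under: $r=_\beta r'$, $s=_\beta s'$ imply $rs=_\beta r's'$; $s=_\beta s'$ implies $\lambda a{:}\phi.s=_\beta\lambda a{:}\phi.s'$; and $(\lambda a{:}\phi.r)t=_\beta r[a:=t]$. Type environments $\Gamma$: functional sets of typings $a{:}\phi$; $\mathrm{dom}(\Gamma)$ their atoms. Typing rules: $\Gamma,a{:}\phi\vdash a:\phi$; $\Gamma\vdash C:\mathrm{type}(C)$;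 $\Gamma,a{:}\phi\vdash r:\psi$ ($a\notin\mathrm{dom}(\Gamma)$) gives $\Gamma\vdash\lambda a{:}\phi.r:\phi\to\psi$; $\Gamma\vdash r:\phi\to\psi$, $\Gamma\vdash s:\phi$ give $\Gamma\vdash rs:\psi$. Model: $\mathcal I$ assigns to each $\Gamma,\phi$ a finitely-supported set $\mathcal I_\Gamma(\phi)$, with $a^{\mathcal I}_\phi\in\mathcal I_\Gamma(\phi)$ for $a{:}\phi\in\Gamma$, $C^{\mathcal I}\in\mathcal I_\Gamma(\mathrm{type}(C))$, abstraction $[a{:}\phi]x\in\mathcal I_\Gamma(\phi\to\psi)$ for $x\in\mathcal I_{\Gamma,a:\phi}(\psi)$, application $x\bullet y\in\mathcal I_\Gamma(\psi)$ for $x\in\mathcal I_\Gamma(\phi\to\psi),y\in\mathcal I_\Gamma(\phi)$; satisfying $\mathcal I_{\Gamma\cap\Gamma'}(\phi)=\mathcal I_\Gamma(\phi)\cap\mathcal I_{\Gamma'}(\phi)$; $\mathrm{supp}(x)\subseteq\mathrm{dom}(\Gamma)$ for $x\in\mathcal I_\Gamma(\phi)$; equivariance ($\pi\cdot\mathcal I_\Gamma(\phi)=\mathcal I_{\pi\cdot\Gamma}(\phi)$, $\pi\cdot a^{\mathcal I}_\phi=\pi(a)^{\mathcal I}_\phi$, $\pi\cdot C^{\mathcal I}=C^{\mathcal I}$, $\pi\cdot[a{:}\phi]x=[\pi(a){:}\phi]\pi\cdot x$, $\pi\cdot(x\bullet y)=\pi\cdot x\bullet\pi\cdot y$); and with $x[a\mapsto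 y]:=([a{:}\phi]x)\bullet y$: $a^{\mathcal I}_\phi[a\mapsto x]=x$; $a\#z\Rightarrow z[a\mapsto x]=z$; $(z'\bullet z)[a\mapsto x]=(z'[a\mapsto x])\bullet(z[a\mapsto x])$; $c\#x\Rightarrow([c{:}\chi]z)[a\mapsto x]=[c{:}\chi](z[a\mapsto x])$. Interpretation of $\Gamma\vdash r:\phi$ in $\mathcal I$: $[\![a]\!]^{\mathcal I}_\Gamma=a^{\mathcal I}_\phi$, $[\![C]\!]^{\mathcal I}_\Gamma=C^{\mathcal I}$, $[\![rs]\!]^{\mathcal I}_\Gamma=[\![r]\!]^{\mathcal I}_\Gamma\bullet[\![s]\!]^{\mathcal I}_\Gamma$, $[\![\lambda a{:}\phi.r]\!]^{\mathcal I}_\Gamma=[a{:}\phi][\![r]\!]^{\mathcal I}_{\Gamma,a:\phi}$.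
   Formalization: Type environments are taken to be finite, both for Γ and in the definition of a model; with arbitrary infinite functional sets of typings, the finite-support, equivariance and intersection axioms make all atoms of a type equal in every model, so the claim would fail. *)

theory Defs
  imports "HOL-Combinatorics.Perm"
begin

unbundle permutation_syntax

section \<open>Atoms, permutations and support\<close>

datatype atom = Atom nat

lemma infinite_atom: "infinite (UNIV :: atom set)"
proof -
  have "inj Atom" by (simp add: inj_def)
  then have "infinite (range Atom)" by (simp add: finite_image_iff)
  then show ?thesis by (rule infinite_super[OF subset_UNIV])
qed

definition fresh_atom :: "atom set \<Rightarrow> atom" where
  "fresh_atom A = (SOME c. c \<notin> A)"

lemma fresh_atom: "finite A \<Longrightarrow> fresh_atom A \<notin> A"
  unfolding fresh_atom_def by (rule someI_ex) (rule ex_new_if_finite[OF infinite_atom])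

text \<open>The type \<^typ>\<open>atom perm\<close> consists of the bijections moving finitely many atoms; an action of
  it on a type is passed as the parameter \<open>act\<close>.\<close>

definition supports :: "(atom perm \<Rightarrow> 'x \<Rightarrow> 'x) \<Rightarrow> atom set \<Rightarrow> 'x \<Rightarrow> bool" where
  "supports act A x \<longleftrightarrow> (\<forall>\<pi>. (\<forall>a\<in>A. \<pi> \<langle>$\<rangle> a = a) \<longrightarrow> act \<pi> x = x)"

definition finitely_supported :: "(atom perm \<Rightarrow> 'x \<Rightarrow> 'x) \<Rightarrow> 'x \<Rightarrow> bool" where
  "finitely_supported act x \<longleftrightarrow> (\<exists>A. finite A \<and> supports act A x)"

text \<open>For finitely supported \<open>x\<close> the intersection is itself the least finite supporting set
  (\<open>supports_supp\<close> below); otherwise it is \<^term>\<open>UNIV\<close>, so a finite bound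
  on \<open>supp act x\<close> entails that \<open>x\<close> is finitely supported.\<close>

definition supp :: "(atom perm \<Rightarrow> 'x \<Rightarrow> 'x) \<Rightarrow> 'x \<Rightarrow> atom set" where
  "supp act x = \<Inter>{A. finite A \<and> supports act A x}"

lemma swap_supp:
  fixes act :: "atom perm \<Rightarrow> 'x \<Rightarrow> 'x"
  assumes act: "\<And>\<pi> \<rho> x. act (\<pi> * \<rho>) x = act \<pi> (act \<rho> x)" "\<And>x. act 1 x = x"
    and "a \<notin> supp act x" "b \<notin> supp act x"
  shows "act \<langle>a \<leftrightarrow> b\<rangle> x = x"
proof -
  obtain A B where A: "finite A" "supports act A x" "a \<notin> A" and B: "finite B" "supports act B x" "b \<notin> B"
    using assms(3,4) by (auto simp: supp_def)
  define c where "c = fresh_atom (A \<union> B \<union> {a, b})"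
  have c: "c \<notin> A \<union> B \<union> {a, b}"
    unfolding c_def by (rule fresh_atom) (simp add: A B)
  have "\<forall>d\<in>A. \<langle>a \<leftrightarrow> c\<rangle> \<langle>$\<rangle> d = d"
    using c A(3) by (metis UnCI apply_swap_same)
  then have ac: "act \<langle>a \<leftrightarrow> c\<rangle> x = x"
    using A(2) by (simp add: supports_def)
  have "\<forall>d\<in>B. \<langle>b \<leftrightarrow> c\<rangle> \<langle>$\<rangle> d = d"
    using c B(3) by (metis UnCI apply_swap_same)
  then have bc: "act \<langle>b \<leftrightarrow> c\<rangle> x = x"
    using B(2) by (simp add: supports_def)
  show ?thesis
  proof (cases "a = b")
    case False
    have "\<langle>a \<leftrightarrow> b\<rangle> = \<langle>a \<leftrightarrow> c\<rangle> * (\<langle>b \<leftrightarrow> c\<rangle> * \<langle>a \<leftrightarrow> c\<rangle>)"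
    proof (rule perm_eqI)
      fix d
      show "\<langle>a \<leftrightarrow> b\<rangle> \<langle>$\<rangle> d = (\<langle>a \<leftrightarrow> c\<rangle> * (\<langle>b \<leftrightarrow> c\<rangle> * \<langle>a \<leftrightarrow> c\<rangle>)) \<langle>$\<rangle> d"
        using c False by (cases "d = a"; cases "d = b"; cases "d = c") (auto simp: apply_times)
    qed
    then show ?thesis by (simp add: act ac bc)
  qed (simp add: act)
qed

lemma supports_supp:
  fixes act :: "atom perm \<Rightarrow> 'x \<Rightarrow> 'x"
  assumes act: "\<And>\<pi> \<rho> x. act (\<pi> * \<rho>) x = act \<pi> (act \<rho> x)" "\<And>x. act 1 x = x"
  shows "supports act (supp act x) x"
  unfolding supports_def
proof (intro allI impI)
  fix \<pi>
  assume "\<forall>a\<in>supp act x. \<pi> \<langle>$\<rangle> a = a"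
  then show "act \<pi> x = x"
  proof (induction "card (affected \<pi>)" arbitrary: \<pi> rule: less_induct)
    case less
    show ?case
    proof (cases "affected \<pi> = {}")
      case False
      then obtain a where "a \<in> affected \<pi>" by blast
      then have a: "\<pi> \<langle>$\<rangle> a \<noteq> a" by (simp add: in_affected)
      define b where "b = \<pi> \<langle>$\<rangle> a"
      define \<rho> where "\<rho> = \<langle>a \<leftrightarrow> b\<rangle> * \<pi>"
      have \<rho>: "\<rho> \<langle>$\<rangle> d = (if \<pi> \<langle>$\<rangle> d = a then b else if d = a then a else \<pi> \<langle>$\<rangle> d)" for d
        using a by (auto simp: \<rho>_def b_def apply_times apply_inj)
      have a': "a \<notin> supp act x" using less.prems a by auto
      have b': "b \<notin> supp act x" using less.prems a by (auto simp: b_def apply_inj)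
      have "affected \<rho> \<subseteq> affected \<pi> - {a}"
        using a by (auto simp: in_affected \<rho> b_def apply_inj split: if_splits)
      moreover have "a \<in> affected \<pi>" using a by (simp add: in_affected)
      ultimately have "affected \<rho> \<subset> affected \<pi>" by blast
      then have "card (affected \<rho>) < card (affected \<pi>)"
        by (rule psubset_card_mono[OF finite_affected])
      moreover have "\<forall>d\<in>supp act x. \<rho> \<langle>$\<rangle> d = d"
        using less.prems a' b' by (auto simp: \<rho>)
      ultimately have "act \<rho> x = x" by (rule less.hyps)
      moreover have "\<pi> = \<langle>a \<leftrightarrow> b\<rangle> * \<rho>"
        by (simp add: \<rho>_def flip: mult.assoc)
      ultimately show ?thesis
        using swap_supp[OF act a' b'] by (simp add: act)
    qed (simp add: act)
  qed
qed

section \<open>Sets with atoms\<close>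

text \<open>\<open>'k zfa\<close> is the universe of atoms and of the well-founded sets over them that, hereditarily,
  have at most \<open>|'k|\<close> elements. \<open>Family K f\<close> presents the set \<open>{f k | k \<in> K}\<close>, and
  presentations are identified by extensionality. The lemmas on \<open>zatom\<close>, \<open>zelems\<close>, \<open>zset\<close>
  and \<open>zperm\<close> below show that this is the cumulative universe up to that size, with the
  permutation action \<open>\<pi>\<cdot>a = \<pi>(a)\<close> and \<open>\<pi>\<cdot>X = {\<pi>\<cdot>x | x \<in> X}\<close>.

  No type contains all sets, so a statement about all models is made for all bounds instead:
  with \<open>'j\<close> a free type variable, \<open>('t + 'j) zfa\<close> ranges over the universes whose size bound is an
  arbitrary cardinal of at least \<open>|'t|\<close>.\<close>

datatype 'k family = Urelement atom | Family "'k set" "'k \<Rightarrow> 'k family"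

primrec ext_eq :: "'k family \<Rightarrow> 'k family \<Rightarrow> bool" where
  "ext_eq (Urelement a) t = (t = Urelement a)"
| "ext_eq (Family K f) t = (\<exists>L g. t = Family L g \<and>
     (\<forall>k\<in>K. \<exists>l\<in>L. ext_eq (f k) (g l)) \<and> (\<forall>l\<in>L. \<exists>k\<in>K. ext_eq (f k) (g l)))"

lemma ext_eq_refl: "ext_eq s s"
  by (induction s) auto

lemma ext_eq_sym: "ext_eq s t \<Longrightarrow> ext_eq t s"
proof (induction s arbitrary: t)
  case (Family K f)
  then show ?case by (fastforce)
qed auto

lemma ext_eq_trans: "ext_eq s t \<Longrightarrow> ext_eq t u \<Longrightarrow> ext_eq s u"
proof (induction s arbitrary: t u)
  case (Family K f)
  from Family.prems obtain L g M h where t: "t = Family L g" and u: "u = Family M h"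
    and 1: "\<forall>k\<in>K. \<exists>l\<in>L. ext_eq (f k) (g l)" "\<forall>l\<in>L. \<exists>k\<in>K. ext_eq (f k) (g l)"
    and 2: "\<forall>k\<in>L. \<exists>l\<in>M. ext_eq (g k) (h l)" "\<forall>l\<in>M. \<exists>k\<in>L. ext_eq (g k) (h l)"
    by auto
  have "\<forall>k\<in>K. \<exists>l\<in>M. ext_eq (f k) (h l)"
    using 1(1) 2(1) Family.IH[OF rangeI] by meson
  moreover have "\<forall>l\<in>M. \<exists>k\<in>K. ext_eq (f k) (h l)"
    using 1(2) 2(2) Family.IH[OF rangeI] by meson
  ultimately show ?case by (simp add: u)
qed auto

quotient_type 'k zfa = "'k family" / ext_eq
  by (rule equivpI) (auto intro: reflpI sympI transpI ext_eq_refl ext_eq_sym ext_eq_trans)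

lift_definition zatom :: "atom \<Rightarrow> 'k zfa" is Urelement .

primrec family_perm :: "atom perm \<Rightarrow> 'k family \<Rightarrow> 'k family" where
  "family_perm \<pi> (Urelement a) = Urelement (\<pi> \<langle>$\<rangle> a)"
| "family_perm \<pi> (Family K f) = Family K (\<lambda>k. family_perm \<pi> (f k))"

lift_definition zperm :: "atom perm \<Rightarrow> 'k zfa \<Rightarrow> 'k zfa" is family_perm
proof -
  show "ext_eq (family_perm \<pi> s) (family_perm \<pi> t)" if "ext_eq s t" for \<pi> and s t :: "'k family"
    using that
  proof (induction s arbitrary: t)
    case (Family K f)
    then obtain L g where t: "t = Family L g"
      and 1: "\<forall>k\<in>K. \<exists>l\<in>L. ext_eq (f k) (g l)" "\<forall>l\<in>L. \<exists>k\<in>K. ext_eq (f k) (g l)"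
      by auto
    show ?case using 1 Family.IH[OF rangeI] unfolding t by (simp, meson)
  qed auto
qed

primrec family_elems :: "'k family \<Rightarrow> 'k zfa set" where
  "family_elems (Urelement a) = {}"
| "family_elems (Family K f) = (\<lambda>k. abs_zfa (f k)) ` K"

lift_definition zelems :: "'k zfa \<Rightarrow> 'k zfa set" is family_elems
proof -
  show "family_elems s = family_elems t" if "ext_eq s t" for s t :: "'k family"
    using that
  proof (cases s)
    case (Family K f)
    with that obtain L g where t: "t = Family L g"
      and 1: "\<forall>k\<in>K. \<exists>l\<in>L. ext_eq (f k) (g l)" "\<forall>l\<in>L. \<exists>k\<in>K. ext_eq (f k) (g l)"
      by auto
    have "\<forall>k\<in>K. \<exists>l\<in>L. abs_zfa (f k) = abs_zfa (g l)" "\<forall>l\<in>L. \<exists>k\<in>K. abs_zfa (f k) = abs_zfa (g l)"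
      using 1 by (simp_all add: zfa.abs_eq_iff)
    then show ?thesis unfolding Family t by (auto simp: image_iff) metis+
  qed auto
qed

definition zset :: "'k zfa set \<Rightarrow> 'k zfa" where
  "zset X = (THE x. (\<forall>a. x \<noteq> zatom a) \<and> zelems x = X)"

text \<open>The subsets of the universe that are elements of it are those indexed by a subset of \<open>'k\<close>.\<close>

definition small :: "'k zfa set \<Rightarrow> bool" where
  "small X \<longleftrightarrow> (\<exists>(K :: 'k set) f. X = f ` K)"

lemma abs_zfa_surj: obtains s where "x = abs_zfa s"
proof
  show "x = abs_zfa (rep_zfa x)"
    by (simp only: Quotient_abs_rep[OF Quotient_zfa])
qed

lemma zatom_eq_iff [simp]: "zatom a = zatom b \<longleftrightarrow> a = b"
  by transfer auto

lemma abs_Family_neq_zatom: "abs_zfa (Family K f) \<noteq> zatom a"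
  by (simp add: zatom.abs_eq zfa.abs_eq_iff)

lemma zfa_eqI:
  assumes "\<And>a. x \<noteq> zatom a" "\<And>a. y \<noteq> zatom a" "zelems x = zelems y"
  shows "x = y"
proof -
  obtain s where s': "x = abs_zfa s"
    by (rule abs_zfa_surj)
  obtain t where t': "y = abs_zfa t"
    by (rule abs_zfa_surj)
  note st = s' t'
  have "\<And>a. s \<noteq> Urelement a" "\<And>a. t \<noteq> Urelement a"
    using assms(1,2) by (auto simp: st zatom.abs_eq)
  then obtain K f L g where s: "s = Family K f" and t: "t = Family L g"
    by (cases s; cases t) auto
  have *: "(\<lambda>k. abs_zfa (f k)) ` K = (\<lambda>k. abs_zfa (g k)) ` L"
    using assms(3) by (simp add: st s t zelems.abs_eq)
  then have "\<exists>l\<in>L. abs_zfa (f k) = abs_zfa (g l)" if "k \<in> K" for k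
    using that by blast
  moreover have "\<exists>k\<in>K. abs_zfa (f k) = abs_zfa (g l)" if "l \<in> L" for l
  proof -
    have "abs_zfa (g l) \<in> (\<lambda>k. abs_zfa (f k)) ` K"
      unfolding * using that by (rule imageI)
    then show ?thesis by force
  qed
  ultimately have "ext_eq s t"
    by (simp add: s t zfa.abs_eq_iff)
  then show ?thesis by (simp add: st zfa.abs_eq_iff)
qed

lemma zset_exists:
  assumes "small X"
  shows "\<exists>x :: 'k zfa. (\<forall>a. x \<noteq> zatom a) \<and> zelems x = X"
proof -
  obtain K :: "'k set" and f where X: "X = f ` K" using assms by (auto simp: small_def)
  define x where "x = abs_zfa (Family K (\<lambda>k. rep_zfa (f k)))"
  have "zelems x = X"
    by (simp add: x_def X zelems.abs_eq Quotient_abs_rep[OF Quotient_zfa])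
  moreover have "x \<noteq> zatom a" for a
    by (simp add: x_def zatom.abs_eq zfa.abs_eq_iff)
  ultimately show ?thesis by blast
qed

lemma
  assumes "small X"
  shows zset_neq_zatom: "zset X \<noteq> zatom a" and zelems_zset: "zelems (zset X) = X"
proof -
  have "\<exists>!x. (\<forall>a. x \<noteq> zatom a) \<and> zelems x = X"
    using zset_exists[OF assms] zfa_eqI by metis
  from theI'[OF this] show "zset X \<noteq> zatom a" "zelems (zset X) = X"
    by (auto simp: zset_def)
qed

lemma zelems_zatom [simp]: "zelems (zatom a) = {}"
  by transfer simp

lemma small_zelems: "small (zelems x)"
proof (induction x rule: zfa.abs_induct)
  case (1 s)
  show ?case
  proof (cases s)
    case (Urelement a)
    then show ?thesis by (auto simp: small_def zelems.abs_eq intro: exI[of _ "{}"])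
  next
    case (Family K f)
    then show ?thesis by (auto simp: small_def zelems.abs_eq)
  qed
qed

lemma zfa_cases:
  obtains (zatom) a where "x = zatom a" | (zset) X where "small X" "x = zset X"
proof (cases "\<exists>a. x = zatom a")
  case False
  then have "x = zset (zelems x)"
    by (intro zfa_eqI) (use False in \<open>auto simp: zset_neq_zatom zelems_zset small_zelems\<close>)
  then show ?thesis using that(2) small_zelems by blast
qed (use that in blast)

lemma zfa_induct:
  assumes "\<And>a. P (zatom a)" and "\<And>X. small X \<Longrightarrow> (\<And>x. x \<in> X \<Longrightarrow> P x) \<Longrightarrow> P (zset X)"
  shows "P x"
proof (induction x rule: zfa.abs_induct)
  case (1 s)
  show ?case
  proof (induction s)
    case (Urelement a)
    show ?case using assms(1) by (simp add: zatom.abs_eq)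
  next
    case (Family K f)
    let ?X = "(\<lambda>k. abs_zfa (f k)) ` K"
    have sm: "small ?X" by (auto simp: small_def)
    have "abs_zfa (Family K f) = zset ?X"
      by (rule zfa_eqI)
        (simp_all add: zset_neq_zatom[OF sm] zelems_zset[OF sm] zelems.abs_eq abs_Family_neq_zatom)
    then show ?case using assms(2)[OF sm] Family.IH by auto
  qed
qed

lemma small_image:
  fixes f :: "'k zfa \<Rightarrow> 'k zfa"
  assumes "small X"
  shows "small (f ` X)"
proof -
  obtain K :: "'k set" and g where "X = g ` K" using assms by (auto simp: small_def)
  then have "f ` X = (\<lambda>k. f (g k)) ` K" by (simp add: image_image)
  then show ?thesis unfolding small_def by (intro exI)
qed

lemma zperm_zatom [simp]: "zperm \<pi> (zatom a) = zatom (\<pi> \<langle>$\<rangle> a)"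
  by transfer (simp add: ext_eq_refl)

lemma zelems_zperm: "zelems (zperm \<pi> x) = zperm \<pi> ` zelems x"
proof (induction x rule: zfa.abs_induct)
  case (1 s)
  show ?case
  proof (cases s)
    case (Urelement a)
    then show ?thesis by (simp add: zperm.abs_eq zelems.abs_eq)
  next
    case (Family K f)
    then show ?thesis by (simp add: zperm.abs_eq zelems.abs_eq image_image)
  qed
qed

lemma zperm_not_zatom:
  assumes "\<And>a. x \<noteq> zatom a"
  shows "zperm \<pi> x \<noteq> zatom b"
proof -
  obtain s where s: "x = abs_zfa s"
    by (rule abs_zfa_surj)
  have "\<And>a. s \<noteq> Urelement a"
    using assms by (auto simp: s zatom.abs_eq)
  then obtain K f where "s = Family K f"
    by (metis family.exhaust)
  then show ?thesis
    by (simp add: s zperm.abs_eq abs_Family_neq_zatom)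
qed

lemma zperm_zset:
  assumes "small X"
  shows "zperm \<pi> (zset X) = zset (zperm \<pi> ` X)"
proof (rule zfa_eqI)
  show "zperm \<pi> (zset X) \<noteq> zatom a" for a
    by (rule zperm_not_zatom) (rule zset_neq_zatom[OF assms])
  show "zset (zperm \<pi> ` X) \<noteq> zatom a" for a
    by (rule zset_neq_zatom) (rule small_image[OF assms])
  show "zelems (zperm \<pi> (zset X)) = zelems (zset (zperm \<pi> ` X))"
    by (simp only: zelems_zperm zelems_zset[OF assms] zelems_zset[OF small_image[OF assms]])
qed

lemma zperm_times: "zperm (\<pi> * \<rho>) x = zperm \<pi> (zperm \<rho> x)"
proof (induction x rule: zfa.abs_induct)
  case (1 s)
  have "family_perm (\<pi> * \<rho>) s = family_perm \<pi> (family_perm \<rho> s)"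
    by (induction s) (simp_all add: apply_times)
  then show ?case by (simp add: zperm.abs_eq)
qed

lemma zperm_one: "zperm 1 x = x"
proof (induction x rule: zfa.abs_induct)
  case (1 s)
  have "family_perm 1 s = s"
    by (induction s) simp_all
  then show ?case by (simp add: zperm.abs_eq)
qed

section \<open>Types and terms\<close>

datatype 'b ty = Base 'b | Fun "'b ty" "'b ty"

datatype ('b, 'c) raw_trm =
    RVar atom
  | RCon 'c
  | RLam atom "'b ty" "('b, 'c) raw_trm"
  | RApp "('b, 'c) raw_trm" "('b, 'c) raw_trm"

primrec raw_fv :: "('b, 'c) raw_trm \<Rightarrow> atom set" where
  "raw_fv (RVar a) = {a}"
| "raw_fv (RCon C) = {}"
| "raw_fv (RLam a \<phi> r) = raw_fv r - {a}"
| "raw_fv (RApp r s) = raw_fv r \<union> raw_fv s"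

primrec raw_perm :: "atom perm \<Rightarrow> ('b, 'c) raw_trm \<Rightarrow> ('b, 'c) raw_trm" where
  "raw_perm \<pi> (RVar a) = RVar (\<pi> \<langle>$\<rangle> a)"
| "raw_perm \<pi> (RCon C) = RCon C"
| "raw_perm \<pi> (RLam a \<phi> r) = RLam (\<pi> \<langle>$\<rangle> a) \<phi> (raw_perm \<pi> r)"
| "raw_perm \<pi> (RApp r s) = RApp (raw_perm \<pi> r) (raw_perm \<pi> s)"

inductive alpha :: "('b, 'c) raw_trm \<Rightarrow> ('b, 'c) raw_trm \<Rightarrow> bool" where
  alpha_refl: "alpha r r"
| alpha_sym: "alpha r s \<Longrightarrow> alpha s r"
| alpha_trans: "alpha r s \<Longrightarrow> alpha s t \<Longrightarrow> alpha r t"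
| alpha_App: "alpha r r' \<Longrightarrow> alpha s s' \<Longrightarrow> alpha (RApp r s) (RApp r' s')"
| alpha_Lam: "alpha r r' \<Longrightarrow> alpha (RLam a \<phi> r) (RLam a \<phi> r')"
| alpha_rename: "b \<notin> raw_fv r \<Longrightarrow> alpha (RLam a \<phi> r) (RLam b \<phi> (raw_perm \<langle>a \<leftrightarrow> b\<rangle> r))"

lemma finite_raw_fv [simp]: "finite (raw_fv r)"
  by (induction r) auto

lemma raw_fv_perm: "raw_fv (raw_perm \<pi> r) = (\<lambda>a. \<pi> \<langle>$\<rangle> a) ` raw_fv r"
  by (induction r) (auto simp: image_Un image_set_diff[OF bij_is_inj[OF bij_apply]])

lemma size_raw_perm [simp]: "size (raw_perm \<pi> r) = size r"
  by (induction r) auto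

lemma raw_perm_one [simp]: "raw_perm 1 r = r"
  by (induction r) auto

lemma raw_perm_perm: "raw_perm \<pi> (raw_perm \<rho> r) = raw_perm (\<pi> * \<rho>) r"
  by (induction r) (auto simp: apply_sequence)

lemma perm_conj_swap: "\<pi> * \<langle>a \<leftrightarrow> b\<rangle> = \<langle>\<pi> \<langle>$\<rangle> a \<leftrightarrow> \<pi> \<langle>$\<rangle> b\<rangle> * \<pi>"
proof (rule perm_eqI)
  fix c
  show "(\<pi> * \<langle>a \<leftrightarrow> b\<rangle>) \<langle>$\<rangle> c = (\<langle>\<pi> \<langle>$\<rangle> a \<leftrightarrow> \<pi> \<langle>$\<rangle> b\<rangle> * \<pi>) \<langle>$\<rangle> c"
    by (cases "c = a"; cases "c = b") (simp_all add: apply_sequence[symmetric] apply_inj)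
qed

lemma raw_fv_alpha: "alpha r s \<Longrightarrow> raw_fv r = raw_fv s"
proof (induction rule: alpha.induct)
  case (alpha_rename b r a \<phi>)
  show ?case
  proof (cases "a = b")
    case False
    have *: "\<langle>a \<leftrightarrow> b\<rangle> \<langle>$\<rangle> c = (if c = a then b else if c = b then a else c)" for c
      by auto
    show ?thesis
      using alpha_rename by (auto simp: raw_fv_perm * image_iff)
  qed simp
qed auto

lemma alpha_perm: "alpha r s \<Longrightarrow> alpha (raw_perm \<pi> r) (raw_perm \<pi> s)"
proof (induction rule: alpha.induct)
  case (alpha_rename b r a \<phi>)
  have "\<pi> \<langle>$\<rangle> b \<notin> raw_fv (raw_perm \<pi> r)"
    using alpha_rename by (auto simp: raw_fv_perm apply_inj)
  from alpha.alpha_rename[OF this, of "\<pi> \<langle>$\<rangle> a" \<phi>] show ?case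
    by (simp add: raw_perm_perm perm_conj_swap)
qed (auto intro: alpha.intros)

text \<open>Capture-avoiding simultaneous substitution. The bound atom is always renamed, and the new
  one depends only on the free atoms of the result, so that \<open>\<alpha>\<close>-equivalent terms
  have equal results.\<close>

primrec raw_subst :: "(atom \<Rightarrow> ('b, 'c) raw_trm) \<Rightarrow> ('b, 'c) raw_trm \<Rightarrow> ('b, 'c) raw_trm" where
  "raw_subst \<sigma> (RVar a) = \<sigma> a"
| "raw_subst \<sigma> (RCon C) = RCon C"
| "raw_subst \<sigma> (RLam a \<phi> r) =
     (let c = fresh_atom (\<Union>b\<in>raw_fv r - {a}. raw_fv (\<sigma> b))
      in RLam c \<phi> (raw_subst (\<sigma>(a := RVar c)) r))"
| "raw_subst \<sigma> (RApp r s) = RApp (raw_subst \<sigma> r) (raw_subst \<sigma> s)"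

lemma raw_subst_cong: "(\<And>a. a \<in> raw_fv r \<Longrightarrow> \<sigma> a = \<tau> a) \<Longrightarrow> raw_subst \<sigma> r = raw_subst \<tau> r"
proof (induction r arbitrary: \<sigma> \<tau>)
  case (RLam a \<phi> r)
  have "(\<Union>b\<in>raw_fv r - {a}. raw_fv (\<sigma> b)) = (\<Union>b\<in>raw_fv r - {a}. raw_fv (\<tau> b))"
    by (rule SUP_cong) (simp_all add: RLam.prems)
  moreover have "raw_subst (\<sigma>(a := RVar c)) r = raw_subst (\<tau>(a := RVar c)) r" for c
    by (rule RLam.IH) (simp add: RLam.prems)
  ultimately show ?case by (simp only: raw_subst.simps)
next
  case (RApp r s)
  have "raw_subst \<sigma> r = raw_subst \<tau> r"
    by (rule RApp.IH) (simp add: RApp.prems)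
  moreover have "raw_subst \<sigma> s = raw_subst \<tau> s"
    by (rule RApp.IH) (simp add: RApp.prems)
  ultimately show ?case by simp
qed simp_all

lemma raw_subst_perm: "raw_subst \<sigma> (raw_perm \<pi> r) = raw_subst (\<lambda>a. \<sigma> (\<pi> \<langle>$\<rangle> a)) r"
proof (induction r arbitrary: \<sigma>)
  case (RLam a \<phi> r)
  have "raw_fv (raw_perm \<pi> r) - {\<pi> \<langle>$\<rangle> a} = (\<lambda>b. \<pi> \<langle>$\<rangle> b) ` (raw_fv r - {a})"
    by (auto simp: raw_fv_perm apply_inj)
  then have "(\<Union>b\<in>raw_fv (raw_perm \<pi> r) - {\<pi> \<langle>$\<rangle> a}. raw_fv (\<sigma> b))
    = (\<Union>b\<in>raw_fv r - {a}. raw_fv (\<sigma> (\<pi> \<langle>$\<rangle> b)))"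
    by simp
  moreover have "(\<lambda>b. (\<sigma>(\<pi> \<langle>$\<rangle> a := RVar c)) (\<pi> \<langle>$\<rangle> b)) = (\<lambda>b. \<sigma> (\<pi> \<langle>$\<rangle> b))(a := RVar c)" for c
    by (auto simp: apply_inj)
  ultimately show ?case by (simp add: Let_def RLam.IH)
qed auto

lemma raw_subst_alpha: "alpha r s \<Longrightarrow> raw_subst \<sigma> r = raw_subst \<sigma> s"
proof (induction arbitrary: \<sigma> rule: alpha.induct)
  case (alpha_Lam r r' a \<phi>)
  then have "raw_fv r = raw_fv r'" by (simp add: raw_fv_alpha)
  then show ?case by (simp only: raw_subst.simps Let_def alpha_Lam.IH)
next
  case (alpha_rename b r a \<phi>)
  show ?case
  proof (cases "a = b")
    case False
    let ?p = "\<langle>a \<leftrightarrow> b\<rangle>"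
    have "raw_fv (RLam b \<phi> (raw_perm ?p r)) = raw_fv (RLam a \<phi> r)"
      using raw_fv_alpha[OF alpha.alpha_rename[OF alpha_rename]] by simp
    then have "raw_fv (raw_perm ?p r) - {b} = raw_fv r - {a}" by simp
    moreover have "raw_subst (\<sigma>(b := RVar c)) (raw_perm ?p r) = raw_subst (\<sigma>(a := RVar c)) r" for c
      unfolding raw_subst_perm
    proof (rule raw_subst_cong)
      fix d
      assume "d \<in> raw_fv r"
      then have "d \<noteq> b" using alpha_rename by auto
      then show "(\<sigma>(b := RVar c)) (?p \<langle>$\<rangle> d) = (\<sigma>(a := RVar c)) d"
        using False by (cases "d = a") auto
    qed
    ultimately show ?thesis by (simp add: Let_def)
  qed simp
qed auto

lemma raw_subst_alpha_cong:
  "(\<And>a. a \<in> raw_fv r \<Longrightarrow> alpha (\<sigma> a) (\<tau> a)) \<Longrightarrow> alpha (raw_subst \<sigma> r) (raw_subst \<tau> r)"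
proof (induction r arbitrary: \<sigma> \<tau>)
  case (RLam a \<phi> r)
  have "(\<Union>b\<in>raw_fv r - {a}. raw_fv (\<sigma> b)) = (\<Union>b\<in>raw_fv r - {a}. raw_fv (\<tau> b))"
    by (rule SUP_cong) (simp_all add: raw_fv_alpha[OF RLam.prems])
  moreover have "alpha (raw_subst (\<sigma>(a := RVar c)) r) (raw_subst (\<tau>(a := RVar c)) r)" for c
    by (rule RLam.IH) (simp add: RLam.prems alpha_refl)
  ultimately show ?case by (simp add: Let_def alpha.alpha_Lam)
next
  case (RApp r s)
  have "alpha (raw_subst \<sigma> r) (raw_subst \<tau> r)"
    by (rule RApp.IH) (simp add: RApp.prems)
  moreover have "alpha (raw_subst \<sigma> s) (raw_subst \<tau> s)"
    by (rule RApp.IH) (simp add: RApp.prems)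
  ultimately show ?case by (simp add: alpha.alpha_App)
qed (simp_all add: alpha_refl)

lemma alpha_canonical: "alpha r (raw_subst RVar r)"
proof (induction r rule: measure_induct_rule[of size])
  case (less r)
  show ?case
  proof (cases r)
    case (RLam a \<phi> s)
    define c where "c = fresh_atom (raw_fv s - {a})"
    have c: "c \<notin> raw_fv s - {a}" unfolding c_def by (rule fresh_atom) simp
    have "raw_subst (RVar(a := RVar c)) s = raw_subst RVar (raw_perm \<langle>a \<leftrightarrow> c\<rangle> s)"
      unfolding raw_subst_perm
    proof (rule raw_subst_cong)
      fix d
      assume "d \<in> raw_fv s"
      then have "d = a \<or> d \<noteq> a \<and> d \<noteq> c" using c by blast
      then show "(RVar(a := RVar c)) d = RVar (\<langle>a \<leftrightarrow> c\<rangle> \<langle>$\<rangle> d)"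
        by (elim disjE conjE) simp_all
    qed
    moreover have "alpha (raw_perm \<langle>a \<leftrightarrow> c\<rangle> s) (raw_subst RVar (raw_perm \<langle>a \<leftrightarrow> c\<rangle> s))"
      by (rule less.IH) (simp add: RLam size_raw_perm)
    ultimately have "alpha (RLam c \<phi> (raw_perm \<langle>a \<leftrightarrow> c\<rangle> s)) (raw_subst RVar r)"
      by (simp add: RLam Let_def alpha_Lam flip: c_def)
    moreover have "alpha (RLam a \<phi> s) (RLam c \<phi> (raw_perm \<langle>a \<leftrightarrow> c\<rangle> s))"
    proof (cases "c = a")
      case False
      then have "c \<notin> raw_fv s" using c by simp
      then show ?thesis by (rule alpha_rename)
    qed (simp add: alpha_refl)
    ultimately show ?thesis unfolding RLam by (rule alpha_trans[rotated])
  next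
    case (RApp s t)
    have "alpha s (raw_subst RVar s)" "alpha t (raw_subst RVar t)"
      by (rule less.IH, simp add: RApp)+
    then show ?thesis unfolding RApp by (simp add: alpha_App)
  qed (simp_all add: alpha_refl)
qed

lemma alpha_iff: "alpha r s \<longleftrightarrow> raw_subst RVar r = raw_subst RVar s"
  by (metis alpha_canonical alpha_sym alpha_trans raw_subst_alpha)

lemma alpha_perm_cong:
  "(\<And>a. a \<in> raw_fv r \<Longrightarrow> \<pi> \<langle>$\<rangle> a = \<rho> \<langle>$\<rangle> a) \<Longrightarrow> alpha (raw_perm \<pi> r) (raw_perm \<rho> r)"
  unfolding alpha_iff raw_subst_perm by (rule raw_subst_cong) simp

lemma alpha_LamD:
  assumes "alpha (RLam a \<phi> r) (RLam b \<psi> s)"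
  shows "\<phi> = \<psi>" and "a = b \<and> alpha r s \<or> a \<noteq> b \<and> b \<notin> raw_fv r \<and> alpha s (raw_perm \<langle>a \<leftrightarrow> b\<rangle> r)"
proof -
  define c where "c = fresh_atom (raw_fv r - {a})"
  have fv: "raw_fv r - {a} = raw_fv s - {b}"
    using raw_fv_alpha[OF assms] by simp
  have cr: "c \<notin> raw_fv r - {a}" unfolding c_def by (rule fresh_atom) simp
  then have cs: "c \<notin> raw_fv s - {b}" using fv by simp
  have ren: "raw_subst (RVar(x := RVar c)) t = raw_subst RVar (raw_perm \<langle>x \<leftrightarrow> c\<rangle> t)"
    if "c \<notin> raw_fv t - {x}" for x and t :: "('a, 'b) raw_trm"
    unfolding raw_subst_perm
  proof (rule raw_subst_cong)
    fix d
    assume "d \<in> raw_fv t"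
    then have "d = x \<or> d \<noteq> x \<and> d \<noteq> c" using that by blast
    then show "(RVar(x := RVar c)) d = RVar (\<langle>x \<leftrightarrow> c\<rangle> \<langle>$\<rangle> d)"
      by (elim disjE conjE) simp_all
  qed
  have *: "\<phi> = \<psi>" "raw_subst (RVar(a := RVar c)) r = raw_subst (RVar(b := RVar c)) s"
    using assms unfolding alpha_iff by (simp_all add: Let_def flip: fv c_def)
  show "\<phi> = \<psi>" by (rule *(1))
  have ac: "alpha (raw_perm \<langle>a \<leftrightarrow> c\<rangle> r) (raw_perm \<langle>b \<leftrightarrow> c\<rangle> s)"
    using *(2) unfolding ren[OF cr] ren[OF cs] alpha_iff .
  have "alpha (raw_perm \<langle>b \<leftrightarrow> c\<rangle> (raw_perm \<langle>a \<leftrightarrow> c\<rangle> r)) (raw_perm \<langle>b \<leftrightarrow> c\<rangle> (raw_perm \<langle>b \<leftrightarrow> c\<rangle> s))"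
    by (rule alpha_perm[OF ac])
  then have s: "alpha s (raw_perm (\<langle>b \<leftrightarrow> c\<rangle> * \<langle>a \<leftrightarrow> c\<rangle>) r)"
    by (simp add: raw_perm_perm alpha_sym)
  show "a = b \<and> alpha r s \<or> a \<noteq> b \<and> b \<notin> raw_fv r \<and> alpha s (raw_perm \<langle>a \<leftrightarrow> b\<rangle> r)"
  proof (cases "a = b")
    case True
    then show ?thesis using s by (simp add: alpha_sym)
  next
    case False
    have b: "b \<notin> raw_fv r" using fv False by auto
    have "alpha (raw_perm (\<langle>b \<leftrightarrow> c\<rangle> * \<langle>a \<leftrightarrow> c\<rangle>) r) (raw_perm \<langle>a \<leftrightarrow> b\<rangle> r)"
    proof (rule alpha_perm_cong)
      fix d
      assume "d \<in> raw_fv r"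
      with b cr show "(\<langle>b \<leftrightarrow> c\<rangle> * \<langle>a \<leftrightarrow> c\<rangle>) \<langle>$\<rangle> d = \<langle>a \<leftrightarrow> b\<rangle> \<langle>$\<rangle> d"
        by (cases "d = a"; cases "c = a"; cases "d = b"; cases "c = d") (auto simp: apply_times swap_sym)
    qed
    with s b False show ?thesis by (blast intro: alpha_trans)
  qed
qed

lemma raw_fv_subst: "raw_fv (raw_subst \<sigma> r) = (\<Union>a\<in>raw_fv r. raw_fv (\<sigma> a))"
proof (induction r arbitrary: \<sigma>)
  case (RLam a \<phi> r)
  let ?F = "\<Union>b\<in>raw_fv r - {a}. raw_fv (\<sigma> b)"
  define c where "c = fresh_atom ?F"
  have c: "c \<notin> ?F" unfolding c_def by (rule fresh_atom) simp
  have "raw_fv (raw_subst \<sigma> (RLam a \<phi> r)) = (\<Union>b\<in>raw_fv r. raw_fv ((\<sigma>(a := RVar c)) b)) - {c}"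
    by (simp only: raw_subst.simps Let_def raw_fv.simps RLam.IH flip: c_def)
  also have "\<dots> = ?F - {c}" by (auto split: if_splits)
  also have "\<dots> = ?F" using c by blast
  finally show ?case by simp
qed auto

lemma raw_subst_Lam_aux:
  assumes perm: "\<And>\<sigma> \<pi>. alpha (raw_perm \<pi> (raw_subst \<sigma> r)) (raw_subst (\<lambda>a. raw_perm \<pi> (\<sigma> a)) r)"
    and b: "b \<notin> (\<Union>d\<in>raw_fv r - {a}. raw_fv (\<sigma> d))" and c: "c \<notin> (\<Union>d\<in>raw_fv r - {a}. raw_fv (\<sigma> d))"
  shows "alpha (RLam c \<phi> (raw_subst (\<sigma>(a := RVar c)) r)) (RLam b \<phi> (raw_subst (\<sigma>(a := RVar b)) r))"
proof (cases "b = c")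
  case True
  then show ?thesis by (simp add: alpha_refl)
next
  case False
  have "b \<notin> raw_fv (raw_subst (\<sigma>(a := RVar c)) r)"
    using b False by (auto simp: raw_fv_subst split: if_splits)
  then have "alpha (RLam c \<phi> (raw_subst (\<sigma>(a := RVar c)) r))
      (RLam b \<phi> (raw_perm \<langle>c \<leftrightarrow> b\<rangle> (raw_subst (\<sigma>(a := RVar c)) r)))"
    by (rule alpha_rename)
  moreover have "alpha (raw_perm \<langle>c \<leftrightarrow> b\<rangle> (raw_subst (\<sigma>(a := RVar c)) r)) (raw_subst (\<sigma>(a := RVar b)) r)"
  proof (rule alpha_trans[OF perm], rule raw_subst_alpha_cong)
    fix d
    assume d: "d \<in> raw_fv r"
    show "alpha (raw_perm \<langle>c \<leftrightarrow> b\<rangle> ((\<sigma>(a := RVar c)) d)) ((\<sigma>(a := RVar b)) d)"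
    proof (cases "d = a")
      case False
      have "alpha (raw_perm \<langle>c \<leftrightarrow> b\<rangle> (\<sigma> d)) (raw_perm 1 (\<sigma> d))"
      proof (rule alpha_perm_cong)
        fix e
        assume "e \<in> raw_fv (\<sigma> d)"
        then have "e \<noteq> b" "e \<noteq> c" using b c d False by auto
        then show "\<langle>c \<leftrightarrow> b\<rangle> \<langle>$\<rangle> e = 1 \<langle>$\<rangle> e" by simp
      qed
      then show ?thesis using False by simp
    qed (simp add: alpha_refl)
  qed
  ultimately show ?thesis by (blast intro: alpha_trans alpha_Lam)
qed

lemma raw_perm_subst: "alpha (raw_perm \<pi> (raw_subst \<sigma> r)) (raw_subst (\<lambda>a. raw_perm \<pi> (\<sigma> a)) r)"
proof (induction r arbitrary: \<pi> \<sigma>)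
  case (RLam a \<phi> r)
  let ?\<tau> = "\<lambda>a. raw_perm \<pi> (\<sigma> a)"
  let ?F = "\<Union>b\<in>raw_fv r - {a}. raw_fv (\<sigma> b)"
  let ?G = "\<Union>b\<in>raw_fv r - {a}. raw_fv (?\<tau> b)"
  define c where "c = fresh_atom ?F"
  define d where "d = fresh_atom ?G"
  have c: "c \<notin> ?F" unfolding c_def by (rule fresh_atom) simp
  have d: "d \<notin> ?G" unfolding d_def by (rule fresh_atom) simp
  have c': "\<pi> \<langle>$\<rangle> c \<notin> ?G" using c by (auto simp: raw_fv_perm apply_inj)
  have upd: "(\<lambda>b. raw_perm \<pi> ((\<sigma>(a := RVar c)) b)) = ?\<tau>(a := RVar (\<pi> \<langle>$\<rangle> c))"
    by auto
  have "alpha (raw_perm \<pi> (raw_subst (\<sigma>(a := RVar c)) r)) (raw_subst (?\<tau>(a := RVar (\<pi> \<langle>$\<rangle> c))) r)"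
    using RLam.IH[of \<pi> "\<sigma>(a := RVar c)"] unfolding upd .
  then have "alpha (raw_perm \<pi> (raw_subst \<sigma> (RLam a \<phi> r)))
      (RLam (\<pi> \<langle>$\<rangle> c) \<phi> (raw_subst (?\<tau>(a := RVar (\<pi> \<langle>$\<rangle> c))) r))"
    by (simp only: raw_subst.simps raw_perm.simps Let_def alpha_Lam flip: c_def)
  also have "alpha \<dots> (RLam d \<phi> (raw_subst (?\<tau>(a := RVar d)) r))"
    by (rule raw_subst_Lam_aux[OF RLam.IH d c'])
  finally (alpha_trans) show ?case
    by (simp only: raw_subst.simps Let_def flip: d_def)
qed (auto intro: alpha_refl alpha_App)

lemma raw_subst_Lam:
  assumes "b \<notin> (\<Union>d\<in>raw_fv r - {a}. raw_fv (\<sigma> d))"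
  shows "alpha (raw_subst \<sigma> (RLam a \<phi> r)) (RLam b \<phi> (raw_subst (\<sigma>(a := RVar b)) r))"
proof -
  let ?F = "\<Union>b\<in>raw_fv r - {a}. raw_fv (\<sigma> b)"
  have "fresh_atom ?F \<notin> ?F" by (rule fresh_atom) simp
  from raw_subst_Lam_aux[OF raw_perm_subst assms this] show ?thesis
    by (simp only: raw_subst.simps Let_def)
qed

lemma raw_subst_Lam_fresh:
  assumes "b \<noteq> a" "b \<notin> raw_fv t"
  shows "alpha (raw_subst (RVar(a := t)) (RLam b \<phi> r)) (RLam b \<phi> (raw_subst (RVar(a := t)) r))"
proof -
  have "b \<notin> (\<Union>d\<in>raw_fv r - {b}. raw_fv ((RVar(a := t)) d))"
    using assms by auto
  from raw_subst_Lam[OF this]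
  have "alpha (raw_subst (RVar(a := t)) (RLam b \<phi> r)) (RLam b \<phi> (raw_subst (RVar(a := t, b := RVar b)) r))" .
  moreover have "RVar(a := t, b := RVar b) = RVar(a := t)"
    using assms by (auto simp: fun_eq_iff)
  ultimately show ?thesis by simp
qed

quotient_type ('b, 'c) trm = "('b, 'c) raw_trm" / alpha
  by (rule equivpI) (auto intro: reflpI sympI transpI alpha.intros)

lift_definition Var :: "atom \<Rightarrow> ('b, 'c) trm" is RVar .
lift_definition Con :: "'c \<Rightarrow> ('b, 'c) trm" is RCon .
lift_definition Lam :: "atom \<Rightarrow> 'b ty \<Rightarrow> ('b, 'c) trm \<Rightarrow> ('b, 'c) trm" is RLam by (rule alpha_Lam)
lift_definition App :: "('b, 'c) trm \<Rightarrow> ('b, 'c) trm \<Rightarrow> ('b, 'c) trm" is RApp by (rule alpha_App)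
lift_definition fv :: "('b, 'c) trm \<Rightarrow> atom set" is raw_fv by (rule raw_fv_alpha)
lift_definition tperm :: "atom perm \<Rightarrow> ('b, 'c) trm \<Rightarrow> ('b, 'c) trm" is raw_perm by (rule alpha_perm)

lift_definition subst :: "('b, 'c) trm \<Rightarrow> atom \<Rightarrow> ('b, 'c) trm \<Rightarrow> ('b, 'c) trm"
    (\<open>_[_ ::= _]\<close> [1000, 0, 0] 1000)
  is "\<lambda>r a t. raw_subst (RVar(a := t)) r"
proof -
  fix r r' t t' :: "('b, 'c) raw_trm" and a
  assume "alpha r r'" "alpha t t'"
  have "raw_subst (RVar(a := t)) r = raw_subst (RVar(a := t)) r'"
    by (rule raw_subst_alpha) fact
  moreover have "alpha (raw_subst (RVar(a := t)) r') (raw_subst (RVar(a := t')) r')"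
    by (rule raw_subst_alpha_cong) (simp add: \<open>alpha t t'\<close> alpha_refl)
  ultimately show "alpha (raw_subst (RVar(a := t)) r) (raw_subst (RVar(a := t')) r')"
    by simp
qed

lemma subst_Var: "(Var b)[a ::= t] = (if b = a then t else Var b)"
  by transfer (simp add: alpha_refl)

lemma subst_Con: "(Con C)[a ::= t] = Con C"
  by transfer (simp add: alpha_refl)

lemma subst_App: "(App r s)[a ::= t] = App (r[a ::= t]) (s[a ::= t])"
  by transfer (simp add: alpha_refl)

lemma subst_Lam:
  assumes "b \<noteq> a" "b \<notin> fv t"
  shows "(Lam b \<phi> r)[a ::= t] = Lam b \<phi> (r[a ::= t])"
  using assms by transfer (rule raw_subst_Lam_fresh)

lemma Lam_rename: "b \<notin> fv r \<Longrightarrow> Lam a \<phi> r = Lam b \<phi> (tperm \<langle>a \<leftrightarrow> b\<rangle> r)"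
  by transfer (rule alpha_rename)

lemma Lam_eqD:
  assumes "Lam a \<phi> r = Lam b \<psi> s"
  shows "\<phi> = \<psi>" and "a = b \<and> r = s \<or> a \<noteq> b \<and> b \<notin> fv r \<and> s = tperm \<langle>a \<leftrightarrow> b\<rangle> r"
proof -
  define r' s' where "r' = rep_trm r" and "s' = rep_trm s"
  have r: "r = abs_trm r'" and s: "s = abs_trm s'"
    by (simp_all only: r'_def s'_def Quotient_abs_rep[OF Quotient_trm])
  have "alpha (RLam a \<phi> r') (RLam b \<psi> s')"
    using assms by (simp only: r s Lam.abs_eq trm.abs_eq_iff)
  from alpha_LamD[OF this] show "\<phi> = \<psi>"
    and "a = b \<and> r = s \<or> a \<noteq> b \<and> b \<notin> fv r \<and> s = tperm \<langle>a \<leftrightarrow> b\<rangle> r"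
    by (simp_all only: r s trm.abs_eq_iff fv.abs_eq tperm.abs_eq)
qed

lemma Var_eq_iff [simp]: "Var a = Var b \<longleftrightarrow> a = b"
  by transfer (simp add: alpha_iff)

lemma Con_eq_iff [simp]: "Con C = Con D \<longleftrightarrow> C = D"
  by transfer (simp add: alpha_iff)

lemma App_eq_iff [simp]: "App r s = App r' s' \<longleftrightarrow> r = r' \<and> s = s'"
  by transfer (simp add: alpha_iff)

lemma trm_distinct [simp]:
  "Var a \<noteq> Con C" "Var a \<noteq> Lam b \<phi> r" "Var a \<noteq> App r s"
  "Con C \<noteq> Var a" "Con C \<noteq> Lam b \<phi> r" "Con C \<noteq> App r s"
  "Lam b \<phi> r \<noteq> Var a" "Lam b \<phi> r \<noteq> Con C" "Lam b \<phi> r \<noteq> App s t"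
  "App r s \<noteq> Var a" "App r s \<noteq> Con C" "App s t \<noteq> Lam b \<phi> r"
  by (transfer; simp add: alpha_iff Let_def)+

lemma fv_simps [simp]:
  "fv (Var a) = {a}" "fv (Con C) = {}" "fv (Lam a \<phi> r) = fv r - {a}" "fv (App r s) = fv r \<union> fv s"
  by (transfer; simp)+

lemma tperm_simps [simp]:
  "tperm \<pi> (Var a) = Var (\<pi> \<langle>$\<rangle> a)" "tperm \<pi> (Con C) = Con C"
  "tperm \<pi> (Lam a \<phi> r) = Lam (\<pi> \<langle>$\<rangle> a) \<phi> (tperm \<pi> r)" "tperm \<pi> (App r s) = App (tperm \<pi> r) (tperm \<pi> s)"
  by (transfer; simp add: alpha_refl)+

lemma tperm_swap_swap: "tperm \<langle>a \<leftrightarrow> b\<rangle> (tperm \<langle>a \<leftrightarrow> b\<rangle> r) = r"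
  by transfer (simp add: raw_perm_perm alpha_refl)

lemma trm_induct [case_names Var Con Lam App]:
  assumes "\<And>a. P (Var a)" "\<And>C. P (Con C)" "\<And>a \<phi> r. P r \<Longrightarrow> P (Lam a \<phi> r)"
    "\<And>r s. P r \<Longrightarrow> P s \<Longrightarrow> P (App r s)"
  shows "P r"
proof (induction r rule: trm.abs_induct)
  case (1 r)
  then show ?case
    by (induction r) (use assms in \<open>simp_all add: Var.abs_eq[symmetric] Con.abs_eq[symmetric]
      Lam.abs_eq[symmetric] App.abs_eq[symmetric]\<close>)
qed

text \<open>Terms are \<open>\<alpha>\<close>-equivalence classes, so \<open>\<alpha>\<close>-conversion is built into the relation.\<close>

inductive beta_eq :: "('b, 'c) trm \<Rightarrow> ('b, 'c) trm \<Rightarrow> bool" (infix \<open>=\<^sub>\<beta>\<close> 50) where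
  beta_refl: "r =\<^sub>\<beta> r"
| beta_sym: "r =\<^sub>\<beta> s \<Longrightarrow> s =\<^sub>\<beta> r"
| beta_trans: "r =\<^sub>\<beta> s \<Longrightarrow> s =\<^sub>\<beta> t \<Longrightarrow> r =\<^sub>\<beta> t"
| beta_App: "r =\<^sub>\<beta> r' \<Longrightarrow> s =\<^sub>\<beta> s' \<Longrightarrow> App r s =\<^sub>\<beta> App r' s'"
| beta_Lam: "s =\<^sub>\<beta> s' \<Longrightarrow> Lam a \<phi> s =\<^sub>\<beta> Lam a \<phi> s'"
| beta_redex: "App (Lam a \<phi> r) t =\<^sub>\<beta> r[a ::= t]"

section \<open>Type environments and typing\<close>

type_synonym 'b env = "(atom \<times> 'b ty) set"

definition is_env :: "'b env \<Rightarrow> bool" where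
  "is_env \<Gamma> \<longleftrightarrow> finite \<Gamma> \<and> single_valued \<Gamma>"

definition env_perm :: "atom perm \<Rightarrow> 'b env \<Rightarrow> 'b env" where
  "env_perm \<pi> \<Gamma> = (\<lambda>(a, \<phi>). (\<pi> \<langle>$\<rangle> a, \<phi>)) ` \<Gamma>"

text \<open>The environment written \<open>\<Gamma>, a:\<phi>\<close> on paper is \<^term>\<open>insert (a, \<phi>) \<Gamma>\<close> with
  \<^term>\<open>a \<notin> Domain \<Gamma>\<close>. The constants of the signature are the elements of
  \<^term>\<open>dom ctype\<close>, possibly none; an element of \<open>'c\<close> outside \<^term>\<open>dom ctype\<close> is
  untypable, and in an equation \<open>r =\<^sub>\<beta> s\<close> between terms without such elements
  those in intermediate terms can be replaced by any closed term.\<close>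

inductive typing :: "('c \<rightharpoonup> 'b ty) \<Rightarrow> 'b env \<Rightarrow> ('b, 'c) trm \<Rightarrow> 'b ty \<Rightarrow> bool" for ctype where
  typing_Var: "(a, \<phi>) \<in> \<Gamma> \<Longrightarrow> typing ctype \<Gamma> (Var a) \<phi>"
| typing_Con: "ctype C = Some \<phi> \<Longrightarrow> typing ctype \<Gamma> (Con C) \<phi>"
| typing_Lam: "a \<notin> Domain \<Gamma> \<Longrightarrow> typing ctype (insert (a, \<phi>) \<Gamma>) r \<psi> \<Longrightarrow>
    typing ctype \<Gamma> (Lam a \<phi> r) (Fun \<phi> \<psi>)"
| typing_App: "typing ctype \<Gamma> r (Fun \<phi> \<psi>) \<Longrightarrow> typing ctype \<Gamma> s \<phi> \<Longrightarrow>
    typing ctype \<Gamma> (App r s) \<psi>"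

section \<open>Nominal models\<close>

text \<open>The operations are total functions, but the axioms constrain them only on elements of the
  appropriate carriers; elsewhere their values are irrelevant.\<close>

record ('b, 'c, 'k) interp =
  carrier :: "'b env \<Rightarrow> 'b ty \<Rightarrow> 'k zfa set"
  var_el :: "atom \<Rightarrow> 'b ty \<Rightarrow> 'k zfa"
  con_el :: "'c \<Rightarrow> 'k zfa"
  abs_el :: "atom \<Rightarrow> 'b ty \<Rightarrow> 'k zfa \<Rightarrow> 'k zfa"
  app_el :: "'k zfa \<Rightarrow> 'k zfa \<Rightarrow> 'k zfa"

text \<open>\<open>subst_el I a \<phi> x y\<close> is \<open>x[a \<mapsto> y]\<close>, where \<open>\<phi>\<close> is the type at which \<open>a\<close> is abstracted.\<close>

definition subst_el ::
  "('b, 'c, 'k) interp \<Rightarrow> atom \<Rightarrow> 'b ty \<Rightarrow> 'k zfa \<Rightarrow> 'k zfa \<Rightarrow> 'k zfa" where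
  "subst_el I a \<phi> x y = app_el I (abs_el I a \<phi> x) y"

text \<open>The substitution axioms are stated for well-typed arguments: \<open>x\<close> lies in \<open>I\<^sub>\<Gamma>(\<phi>)\<close> and the
  element substituted into lies over \<open>\<Gamma>, a:\<phi>\<close>. Different names denote different atoms, whence
  \<^term>\<open>a \<noteq> c\<close> in \<open>sub_abs\<close>.\<close>

locale nominal_model =
  fixes ctype :: "'c \<rightharpoonup> 'b ty"
    and I :: "('b, 'c, 'k) interp"
  assumes carrier_finitely_supported:
      "is_env \<Gamma> \<Longrightarrow> finitely_supported (\<lambda>\<pi>. (`) (zperm \<pi>)) (carrier I \<Gamma> \<phi>)"
    and var_carrier: "is_env \<Gamma> \<Longrightarrow> (a, \<phi>) \<in> \<Gamma> \<Longrightarrow> var_el I a \<phi> \<in> carrier I \<Gamma> \<phi>"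
    and con_carrier: "is_env \<Gamma> \<Longrightarrow> ctype C = Some \<phi> \<Longrightarrow> con_el I C \<in> carrier I \<Gamma> \<phi>"
    and abs_carrier: "is_env \<Gamma> \<Longrightarrow> a \<notin> Domain \<Gamma> \<Longrightarrow> x \<in> carrier I (insert (a, \<phi>) \<Gamma>) \<psi> \<Longrightarrow>
      abs_el I a \<phi> x \<in> carrier I \<Gamma> (Fun \<phi> \<psi>)"
    and app_carrier: "is_env \<Gamma> \<Longrightarrow> x \<in> carrier I \<Gamma> (Fun \<phi> \<psi>) \<Longrightarrow> y \<in> carrier I \<Gamma> \<phi> \<Longrightarrow>
      app_el I x y \<in> carrier I \<Gamma> \<psi>"
    and carrier_Int: "is_env \<Gamma> \<Longrightarrow> is_env \<Gamma>' \<Longrightarrow>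
      carrier I (\<Gamma> \<inter> \<Gamma>') \<phi> = carrier I \<Gamma> \<phi> \<inter> carrier I \<Gamma>' \<phi>"
    and supp_carrier: "is_env \<Gamma> \<Longrightarrow> x \<in> carrier I \<Gamma> \<phi> \<Longrightarrow> supp zperm x \<subseteq> Domain \<Gamma>"
    and carrier_perm: "is_env \<Gamma> \<Longrightarrow> zperm \<pi> ` carrier I \<Gamma> \<phi> = carrier I (env_perm \<pi> \<Gamma>) \<phi>"
    and var_perm: "zperm \<pi> (var_el I a \<phi>) = var_el I (\<pi> \<langle>$\<rangle> a) \<phi>"
    and con_perm: "ctype C = Some \<phi> \<Longrightarrow> zperm \<pi> (con_el I C) = con_el I C"
    and abs_perm: "is_env \<Gamma> \<Longrightarrow> a \<notin> Domain \<Gamma> \<Longrightarrow> x \<in> carrier I (insert (a, \<phi>) \<Gamma>) \<psi> \<Longrightarrow>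
      zperm \<pi> (abs_el I a \<phi> x) = abs_el I (\<pi> \<langle>$\<rangle> a) \<phi> (zperm \<pi> x)"
    and app_perm: "is_env \<Gamma> \<Longrightarrow> x \<in> carrier I \<Gamma> (Fun \<phi> \<psi>) \<Longrightarrow> y \<in> carrier I \<Gamma> \<phi> \<Longrightarrow>
      zperm \<pi> (app_el I x y) = app_el I (zperm \<pi> x) (zperm \<pi> y)"
    and sub_var: "is_env \<Gamma> \<Longrightarrow> a \<notin> Domain \<Gamma> \<Longrightarrow> x \<in> carrier I \<Gamma> \<phi> \<Longrightarrow>
      subst_el I a \<phi> (var_el I a \<phi>) x = x"
    and sub_fresh: "is_env \<Gamma> \<Longrightarrow> a \<notin> Domain \<Gamma> \<Longrightarrow> x \<in> carrier I \<Gamma> \<phi> \<Longrightarrow>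
      z \<in> carrier I (insert (a, \<phi>) \<Gamma>) \<psi> \<Longrightarrow> a \<notin> supp zperm z \<Longrightarrow> subst_el I a \<phi> z x = z"
    and sub_app: "is_env \<Gamma> \<Longrightarrow> a \<notin> Domain \<Gamma> \<Longrightarrow> x \<in> carrier I \<Gamma> \<phi> \<Longrightarrow>
      z' \<in> carrier I (insert (a, \<phi>) \<Gamma>) (Fun \<chi> \<psi>) \<Longrightarrow> z \<in> carrier I (insert (a, \<phi>) \<Gamma>) \<chi> \<Longrightarrow>
      subst_el I a \<phi> (app_el I z' z) x = app_el I (subst_el I a \<phi> z' x) (subst_el I a \<phi> z x)"
    and sub_abs: "is_env \<Gamma> \<Longrightarrow> a \<notin> Domain \<Gamma> \<Longrightarrow> c \<notin> Domain \<Gamma> \<Longrightarrow> a \<noteq> c \<Longrightarrow> x \<in> carrier I \<Gamma> \<phi> \<Longrightarrow>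
      z \<in> carrier I (insert (c, \<chi>) (insert (a, \<phi>) \<Gamma>)) \<psi> \<Longrightarrow> c \<notin> supp zperm x \<Longrightarrow>
      subst_el I a \<phi> (abs_el I c \<chi> z) x = abs_el I c \<chi> (subst_el I a \<phi> z x)"

section \<open>Interpretation of terms\<close>

inductive denotes :: "('b, 'c, 'k) interp \<Rightarrow> 'b env \<Rightarrow> ('b, 'c) trm \<Rightarrow> 'k zfa \<Rightarrow> bool" for I where
  denotes_Var: "(a, \<phi>) \<in> \<Gamma> \<Longrightarrow> denotes I \<Gamma> (Var a) (var_el I a \<phi>)"
| denotes_Con: "denotes I \<Gamma> (Con C) (con_el I C)"
| denotes_App: "denotes I \<Gamma> r x \<Longrightarrow> denotes I \<Gamma> s y \<Longrightarrow> denotes I \<Gamma> (App r s) (app_el I x y)"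
| denotes_Lam: "a \<notin> Domain \<Gamma> \<Longrightarrow> denotes I (insert (a, \<phi>) \<Gamma>) r x \<Longrightarrow>
    denotes I \<Gamma> (Lam a \<phi> r) (abs_el I a \<phi> x)"

text \<open>For typable \<open>r\<close> in a model the denotation exists and does not depend on the representative
  of a \<open>\<lambda>\<close>-abstraction, and it satisfies the defining recursion equations; see \<open>interp_Var\<close>,
  \<open>interp_Con\<close>, \<open>interp_App\<close> and \<open>interp_Lam\<close> below.\<close>

definition interp :: "('b, 'c, 'k) interp \<Rightarrow> 'b env \<Rightarrow> ('b, 'c) trm \<Rightarrow> 'k zfa" where
  "interp I \<Gamma> r = (THE x. denotes I \<Gamma> r x)"

definition valid ::
  "('c \<rightharpoonup> 'b ty) \<Rightarrow> ('b, 'c, 'k) interp \<Rightarrow> 'b env \<Rightarrow> ('b, 'c) trm \<Rightarrow> ('b, 'c) trm \<Rightarrow> bool" where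
  "valid ctype I \<Gamma> r s \<longleftrightarrow> (\<exists>\<phi>. typing ctype \<Gamma> r \<phi> \<and> typing ctype \<Gamma> s \<phi> \<and>
     interp I \<Gamma> r = interp I \<Gamma> s \<and> interp I \<Gamma> r \<in> carrier I \<Gamma> \<phi>)"

lemma is_env_insert: "is_env \<Gamma> \<Longrightarrow> a \<notin> Domain \<Gamma> \<Longrightarrow> is_env (insert (a, \<phi>) \<Gamma>)"
  by (auto simp: is_env_def single_valued_def)

lemma env_perm_insert [simp]: "env_perm \<pi> (insert (a, \<phi>) \<Gamma>) = insert (\<pi> \<langle>$\<rangle> a, \<phi>) (env_perm \<pi> \<Gamma>)"
  by (simp add: env_perm_def)

lemma Domain_env_perm: "Domain (env_perm \<pi> \<Gamma>) = (\<lambda>a. \<pi> \<langle>$\<rangle> a) ` Domain \<Gamma>"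
  by (force simp: env_perm_def)

lemma is_env_perm: "is_env \<Gamma> \<Longrightarrow> is_env (env_perm \<pi> \<Gamma>)"
  by (auto simp: is_env_def env_perm_def single_valued_def apply_inj)

lemma env_perm_swap:
  assumes "a \<notin> Domain \<Gamma>" "b \<notin> Domain \<Gamma>"
  shows "env_perm \<langle>a \<leftrightarrow> b\<rangle> \<Gamma> = \<Gamma>"
proof -
  have "(\<lambda>(c, \<phi>). (\<langle>a \<leftrightarrow> b\<rangle> \<langle>$\<rangle> c, \<phi>)) p = p" if "p \<in> \<Gamma>" for p
  proof -
    obtain c \<phi> where p: "p = (c, \<phi>)" by (cases p)
    with that assms have "c \<noteq> a" "c \<noteq> b" by auto
    then show ?thesis by (simp add: p)
  qed
  then show ?thesis by (simp add: env_perm_def)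
qed

lemma typing_perm: "typing ctype \<Gamma> r \<phi> \<Longrightarrow> typing ctype (env_perm \<pi> \<Gamma>) (tperm \<pi> r) \<phi>"
proof (induction rule: typing.induct)
  case (typing_Var a \<phi> \<Gamma>)
  then have "(\<pi> \<langle>$\<rangle> a, \<phi>) \<in> env_perm \<pi> \<Gamma>" by (force simp: env_perm_def)
  then show ?case by (simp add: typing.typing_Var)
next
  case (typing_Lam a \<Gamma> \<phi> r \<psi>)
  have "\<pi> \<langle>$\<rangle> a \<notin> Domain (env_perm \<pi> \<Gamma>)"
    using typing_Lam.hyps(1) by (auto simp: Domain_env_perm apply_inj)
  then show ?case using typing_Lam.IH by (simp add: typing.typing_Lam)
next
  case (typing_App \<Gamma> r \<phi> \<psi> s)
  then show ?case by (simp add: typing.typing_App[where \<phi> = \<phi>])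
qed (simp add: typing.typing_Con)

lemma typing_LamE:
  assumes "typing ctype \<Gamma> (Lam a \<phi> r) \<chi>" "a \<notin> Domain \<Gamma>"
  obtains \<psi> where "\<chi> = Fun \<phi> \<psi>" "typing ctype (insert (a, \<phi>) \<Gamma>) r \<psi>"
  using assms(1)
proof cases
  case (typing_Lam b \<phi>' r' \<psi>)
  have \<phi>: "\<phi>' = \<phi>" using Lam_eqD(1)[OF typing_Lam(1)] by simp
  have "typing ctype (insert (a, \<phi>) \<Gamma>) r \<psi>"
    using Lam_eqD(2)[OF typing_Lam(1)[symmetric]]
  proof
    assume "b = a \<and> r' = r"
    then show ?thesis using typing_Lam(4) \<phi> by simp
  next
    assume *: "b \<noteq> a \<and> a \<notin> fv r' \<and> r = tperm \<langle>b \<leftrightarrow> a\<rangle> r'"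
    have "typing ctype (env_perm \<langle>b \<leftrightarrow> a\<rangle> (insert (b, \<phi>') \<Gamma>)) (tperm \<langle>b \<leftrightarrow> a\<rangle> r') \<psi>"
      by (rule typing_perm) (rule typing_Lam(4))
    then show ?thesis
      using * by (simp add: env_perm_swap[OF typing_Lam(3) assms(2)] \<phi>)
  qed
  with typing_Lam(2) \<phi> show ?thesis using that by simp
qed simp_all

inductive_cases typing_AppE: "typing ctype \<Gamma> (App r s) \<psi>"
inductive_cases typing_VarE: "typing ctype \<Gamma> (Var a) \<phi>"
inductive_cases typing_ConE: "typing ctype \<Gamma> (Con C) \<phi>"
inductive_cases denotes_AppE: "denotes I \<Gamma> (App r s) x"
inductive_cases denotes_VarE: "denotes I \<Gamma> (Var a) x"
inductive_cases denotes_ConE: "denotes I \<Gamma> (Con C) x"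

lemma is_envD: "is_env \<Gamma> \<Longrightarrow> (a, \<phi>) \<in> \<Gamma> \<Longrightarrow> (a, \<psi>) \<in> \<Gamma> \<Longrightarrow> \<phi> = \<psi>"
  by (auto simp: is_env_def single_valued_def)

context nominal_model
begin

lemma denotes_carrier_perm:
  assumes "denotes I \<Gamma> r x" "is_env \<Gamma>" "typing ctype \<Gamma> r \<phi>"
  shows "x \<in> carrier I \<Gamma> \<phi> \<and> denotes I (env_perm \<pi> \<Gamma>) (tperm \<pi> r) (zperm \<pi> x)"
  using assms
proof (induction arbitrary: \<phi> rule: denotes.induct)
  case (denotes_Var a \<psi> \<Gamma>)
  have "(a, \<phi>) \<in> \<Gamma>" using denotes_Var.prems(2) by (auto elim: typing_VarE)
  with denotes_Var.hyps have \<psi>: "\<psi> = \<phi>" by (rule is_envD[OF denotes_Var.prems(1)])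
  have "(\<pi> \<langle>$\<rangle> a, \<psi>) \<in> env_perm \<pi> \<Gamma>"
    using denotes_Var.hyps by (force simp: env_perm_def)
  then have "denotes I (env_perm \<pi> \<Gamma>) (Var (\<pi> \<langle>$\<rangle> a)) (var_el I (\<pi> \<langle>$\<rangle> a) \<psi>)"
    by (rule denotes.denotes_Var)
  moreover have "var_el I a \<psi> \<in> carrier I \<Gamma> \<phi>"
    using var_carrier[OF denotes_Var.prems(1) denotes_Var.hyps] by (simp add: \<psi>)
  ultimately show ?case by (simp add: var_perm)
next
  case (denotes_Con \<Gamma> C)
  have "ctype C = Some \<phi>" using denotes_Con.prems(2) by (auto elim: typing_ConE)
  then show ?case using denotes_Con.prems(1) by (simp add: con_perm[of C \<phi>] con_carrier denotes.denotes_Con)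
next
  case (denotes_App \<Gamma> r x s y)
  from denotes_App.prems(2) obtain \<psi> where rs: "typing ctype \<Gamma> r (Fun \<psi> \<phi>)" "typing ctype \<Gamma> s \<psi>"
    by (auto elim: typing_AppE)
  note r = denotes_App.IH(1)[OF denotes_App.prems(1) rs(1)]
  note s = denotes_App.IH(2)[OF denotes_App.prems(1) rs(2)]
  have "zperm \<pi> (app_el I x y) = app_el I (zperm \<pi> x) (zperm \<pi> y)"
    by (rule app_perm[OF denotes_App.prems(1) r[THEN conjunct1] s[THEN conjunct1]])
  moreover have "app_el I x y \<in> carrier I \<Gamma> \<phi>"
    by (rule app_carrier[OF denotes_App.prems(1) r[THEN conjunct1] s[THEN conjunct1]])
  moreover have "denotes I (env_perm \<pi> \<Gamma>) (tperm \<pi> (App r s)) (app_el I (zperm \<pi> x) (zperm \<pi> y))"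
    using r s by (simp add: denotes.denotes_App)
  ultimately show ?case by simp
next
  case (denotes_Lam a \<Gamma> \<psi> r x)
  from denotes_Lam.prems(2) denotes_Lam.hyps(1) obtain \<chi> where
    \<phi>: "\<phi> = Fun \<psi> \<chi>" and r: "typing ctype (insert (a, \<psi>) \<Gamma>) r \<chi>" by (rule typing_LamE)
  have env: "is_env (insert (a, \<psi>) \<Gamma>)"
    by (rule is_env_insert[OF denotes_Lam.prems(1) denotes_Lam.hyps(1)])
  note IH = denotes_Lam.IH[OF env r]
  have "\<pi> \<langle>$\<rangle> a \<notin> Domain (env_perm \<pi> \<Gamma>)"
    using denotes_Lam.hyps(1) by (auto simp: Domain_env_perm apply_inj)
  moreover have "denotes I (insert (\<pi> \<langle>$\<rangle> a, \<psi>) (env_perm \<pi> \<Gamma>)) (tperm \<pi> r) (zperm \<pi> x)"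
    using IH by simp
  ultimately have "denotes I (env_perm \<pi> \<Gamma>) (tperm \<pi> (Lam a \<psi> r)) (abs_el I (\<pi> \<langle>$\<rangle> a) \<psi> (zperm \<pi> x))"
    by (simp add: denotes.denotes_Lam)
  moreover have "zperm \<pi> (abs_el I a \<psi> x) = abs_el I (\<pi> \<langle>$\<rangle> a) \<psi> (zperm \<pi> x)"
    by (rule abs_perm[OF denotes_Lam.prems(1) denotes_Lam.hyps(1) IH[THEN conjunct1]])
  moreover have "abs_el I a \<psi> x \<in> carrier I \<Gamma> \<phi>"
    unfolding \<phi> by (rule abs_carrier[OF denotes_Lam.prems(1) denotes_Lam.hyps(1) IH[THEN conjunct1]])
  ultimately show ?case by simp
qed

lemmas denotes_carrier = denotes_carrier_perm[THEN conjunct1]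
lemmas denotes_perm = denotes_carrier_perm[THEN conjunct2]

lemma denotes_unique:
  assumes "denotes I \<Gamma> r x" "denotes I \<Gamma> r y" "is_env \<Gamma>" "typing ctype \<Gamma> r \<phi>"
  shows "y = x"
  using assms
proof (induction arbitrary: \<phi> y rule: denotes.induct)
  case (denotes_Var a \<psi> \<Gamma>)
  from denotes_Var.prems(1) obtain \<chi> where \<chi>: "(a, \<chi>) \<in> \<Gamma>" and y: "y = var_el I a \<chi>"
    by (auto elim: denotes_VarE)
  have "\<chi> = \<psi>" by (rule is_envD[OF denotes_Var.prems(2) \<chi> denotes_Var.hyps])
  then show ?case by (simp add: y)
next
  case (denotes_Con \<Gamma> C)
  then show ?case by (auto elim: denotes_ConE)
next
  case (denotes_App \<Gamma> r x s y')
  from denotes_App.prems(3) obtain \<psi> where rs: "typing ctype \<Gamma> r (Fun \<psi> \<phi>)" "typing ctype \<Gamma> s \<psi>"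
    by (auto elim: typing_AppE)
  from denotes_App.prems(1) obtain u v where y: "y = app_el I u v" and uv: "denotes I \<Gamma> r u" "denotes I \<Gamma> s v"
    by (auto elim: denotes_AppE)
  have "u = x" by (rule denotes_App.IH(1)[OF uv(1) denotes_App.prems(2) rs(1)])
  moreover have "v = y'" by (rule denotes_App.IH(2)[OF uv(2) denotes_App.prems(2) rs(2)])
  ultimately show ?case by (simp add: y)
next
  case (denotes_Lam a \<Gamma> \<psi> r x)
  note a = denotes_Lam.hyps(1) and env = denotes_Lam.prems(2)
  from denotes_Lam.prems(3) a obtain \<chi> where
    r: "typing ctype (insert (a, \<psi>) \<Gamma>) r \<chi>" by (rule typing_LamE)
  note enva = is_env_insert[OF env a]
  note IH = denotes_Lam.IH[OF _ enva r]
  have x: "x \<in> carrier I (insert (a, \<psi>) \<Gamma>) \<chi>"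
    by (rule denotes_carrier[OF denotes_Lam.hyps(2) enva r])
  from denotes_Lam.prems(1) show ?case
  proof cases
    case (denotes_Lam b \<psi>' r' x')
    have \<psi>': "\<psi>' = \<psi>" using Lam_eqD(1)[OF denotes_Lam(1)] by simp
    from Lam_eqD(2)[OF denotes_Lam(1)] show ?thesis
    proof
      assume *: "a = b \<and> r = r'"
      have "x' = x" by (rule IH) (use denotes_Lam(4) * \<psi>' in simp)
      then show ?thesis using denotes_Lam(2) * \<psi>' by simp
    next
      assume *: "a \<noteq> b \<and> b \<notin> fv r \<and> r' = tperm \<langle>a \<leftrightarrow> b\<rangle> r"
      have b: "b \<notin> Domain \<Gamma>" by (rule denotes_Lam(3))
      have swap: "env_perm \<langle>a \<leftrightarrow> b\<rangle> \<Gamma> = \<Gamma>" by (rule env_perm_swap[OF a b])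
      have "denotes I (env_perm \<langle>a \<leftrightarrow> b\<rangle> (insert (a, \<psi>) \<Gamma>)) (tperm \<langle>a \<leftrightarrow> b\<rangle> r) (zperm \<langle>a \<leftrightarrow> b\<rangle> x)"
        by (rule denotes_perm[OF \<open>denotes I (insert (a, \<psi>) \<Gamma>) r x\<close> enva r])
      have r': "typing ctype (insert (b, \<psi>) \<Gamma>) r' \<chi>"
        using typing_perm[OF r, of "\<langle>a \<leftrightarrow> b\<rangle>"] * swap by simp
      have x': "denotes I (insert (b, \<psi>) \<Gamma>) r' x'"
        using denotes_Lam(4) \<psi>' by simp
      from denotes_perm[OF x' is_env_insert[OF env b] r', of "\<langle>a \<leftrightarrow> b\<rangle>"]
      have "denotes I (insert (a, \<psi>) \<Gamma>) (tperm \<langle>a \<leftrightarrow> b\<rangle> r') (zperm \<langle>a \<leftrightarrow> b\<rangle> x')"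
        by (simp add: swap)
      moreover have "tperm \<langle>a \<leftrightarrow> b\<rangle> r' = r"
        using * by (simp add: tperm_swap_swap)
      ultimately have "zperm \<langle>a \<leftrightarrow> b\<rangle> x' = x"
        by (intro IH) simp
      then have x'_eq: "x' = zperm \<langle>a \<leftrightarrow> b\<rangle> x"
        using zperm_times[of "\<langle>a \<leftrightarrow> b\<rangle>" "\<langle>a \<leftrightarrow> b\<rangle>" x'] by (simp add: zperm_one)
      have "abs_el I a \<psi> x \<in> carrier I \<Gamma> (Fun \<psi> \<chi>)"
        by (rule abs_carrier[OF env a x])
      then have "supp zperm (abs_el I a \<psi> x) \<subseteq> Domain \<Gamma>"
        by (rule supp_carrier[OF env])
      then have "zperm \<langle>a \<leftrightarrow> b\<rangle> (abs_el I a \<psi> x) = abs_el I a \<psi> x"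
        using a b by (intro swap_supp[OF zperm_times zperm_one]; blast)
      then have "abs_el I a \<psi> x = abs_el I b \<psi> x'"
        using abs_perm[OF env a x, of "\<langle>a \<leftrightarrow> b\<rangle>"] by (simp add: x'_eq)
      then show ?thesis using denotes_Lam(2) \<psi>' by simp
    qed
  qed simp_all
qed

lemma denotes_exists: "typing ctype \<Gamma> r \<phi> \<Longrightarrow> \<exists>x. denotes I \<Gamma> r x"
proof (induction rule: typing.induct)
  case (typing_Lam a \<Gamma> \<phi> r \<psi>)
  then obtain x where "denotes I (insert (a, \<phi>) \<Gamma>) r x" by blast
  with typing_Lam.hyps(1) have "denotes I \<Gamma> (Lam a \<phi> r) (abs_el I a \<phi> x)" by (rule denotes_Lam)
  then show ?case by (rule exI)
next
  case (typing_App \<Gamma> r \<phi> \<psi> s)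
  then obtain x y where "denotes I \<Gamma> r x" "denotes I \<Gamma> s y" by blast
  then have "denotes I \<Gamma> (App r s) (app_el I x y)" by (rule denotes_App)
  then show ?case by (rule exI)
qed (rule exI, erule denotes_Var, rule exI, rule denotes_Con)

lemma denotes_iff:
  assumes "is_env \<Gamma>" "typing ctype \<Gamma> r \<phi>"
  shows "denotes I \<Gamma> r x \<longleftrightarrow> interp I \<Gamma> r = x"
proof -
  obtain y where y: "denotes I \<Gamma> r y" using denotes_exists[OF assms(2)] by blast
  then have "interp I \<Gamma> r = y"
    unfolding interp_def using denotes_unique[OF y _ assms] by (rule the_equality)
  with y show ?thesis using denotes_unique[OF y _ assms, of x] by auto
qed

lemma interp_carrier: "is_env \<Gamma> \<Longrightarrow> typing ctype \<Gamma> r \<phi> \<Longrightarrow> interp I \<Gamma> r \<in> carrier I \<Gamma> \<phi>"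
  by (rule denotes_carrier[of \<Gamma> r]) (simp_all add: denotes_iff)

lemma interp_Var:
  assumes "is_env \<Gamma>" "(a, \<phi>) \<in> \<Gamma>"
  shows "interp I \<Gamma> (Var a) = var_el I a \<phi>"
  using denotes_Var[OF assms(2), where I = I] by (simp only: denotes_iff[OF assms(1) typing_Var[OF assms(2)]])

lemma interp_Con:
  assumes "is_env \<Gamma>" "ctype C = Some \<phi>"
  shows "interp I \<Gamma> (Con C) = con_el I C"
  using denotes_Con[of I \<Gamma> C] by (simp only: denotes_iff[OF assms(1) typing_Con[where ctype = ctype, OF assms(2)]])

lemma interp_App:
  assumes "is_env \<Gamma>" "typing ctype \<Gamma> r (Fun \<phi> \<psi>)" "typing ctype \<Gamma> s \<phi>"
  shows "interp I \<Gamma> (App r s) = app_el I (interp I \<Gamma> r) (interp I \<Gamma> s)"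
proof -
  have "denotes I \<Gamma> r (interp I \<Gamma> r)" "denotes I \<Gamma> s (interp I \<Gamma> s)"
    by (simp_all add: denotes_iff[OF assms(1) assms(2)] denotes_iff[OF assms(1) assms(3)])
  then have "denotes I \<Gamma> (App r s) (app_el I (interp I \<Gamma> r) (interp I \<Gamma> s))"
    by (rule denotes_App)
  then show ?thesis
    by (simp only: denotes_iff[OF assms(1) typing_App[OF assms(2,3)]])
qed

lemma interp_Lam:
  assumes "is_env \<Gamma>" "a \<notin> Domain \<Gamma>" "typing ctype (insert (a, \<phi>) \<Gamma>) r \<psi>"
  shows "interp I \<Gamma> (Lam a \<phi> r) = abs_el I a \<phi> (interp I (insert (a, \<phi>) \<Gamma>) r)"
proof -
  have "denotes I (insert (a, \<phi>) \<Gamma>) r (interp I (insert (a, \<phi>) \<Gamma>) r)"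
    by (simp add: denotes_iff[OF is_env_insert[OF assms(1,2)] assms(3)])
  from denotes_Lam[OF assms(2) this] show ?thesis
    by (simp only: denotes_iff[OF assms(1) typing_Lam[OF assms(2,3)]])
qed

end

end

theory Submission
  imports Defs
begin

text \<open>The model consists of \<open>\<beta>\<close>-classes of all terms, typable or not: the axioms of a model never
  require carriers of different types to be separated. Naive \<open>\<beta>\<close>-classes violate
  \<open>I\<^bsub>\<Gamma>\<inter>\<Gamma>'\<^esub>(\<phi>) = I\<^bsub>\<Gamma>\<^esub>(\<phi>) \<inter> I\<^bsub>\<Gamma>'\<^esub>(\<phi>)\<close> when \<open>\<Gamma>\<close> and \<open>\<Gamma>'\<close> give an atom different
  types, so an element is a class together with the typings in \<open>\<Gamma>\<close> of the atoms in its support, that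
  is, of the atoms free in every term of the class. A term then denotes its own class, with no
  appeal to confluence or normalization.\<close>

section \<open>Coding raw terms as sets\<close>

text \<open>Foundation: if \<open>zset X\<close> were an element of \<open>X\<close>, the induction
  hypothesis at that very element would refute it.\<close>

lemma zfa_not_mem_self: "x \<notin> zelems x"
proof (induction x rule: zfa_induct)
  case (2 X)
  then show ?case by (metis zelems_zset)
qed simp

text \<open>The invariant elements do not form a small set, since that set would be an invariant
  element of itself. Hence there are at least \<open>|'k|\<close> of them.\<close>

lemma invariant_labels:
  "\<exists>g :: 'k \<Rightarrow> 'k zfa. inj g \<and> (\<forall>\<pi> k. zperm \<pi> (g k) = g k)"
proof -
  define P :: "'k zfa set" where "P = {x. \<forall>\<pi>. zperm \<pi> x = x}"
  have "\<not> small P"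
  proof
    assume P: "small P"
    have "zperm \<pi> ` P = P" for \<pi>
      by (force simp: P_def)
    then have "zset P \<in> P"
      by (simp add: P_def zperm_zset P[unfolded P_def])
    then show False
      using zfa_not_mem_self[of "zset P"] by (simp add: zelems_zset[OF P])
  qed
  moreover have "small P" if "inj_on f P" for f :: "'k zfa \<Rightarrow> 'k"
    unfolding small_def
    using inv_into_image_cancel[OF that order_refl] by metis
  \<comment> \<open>Comparability of cardinals: the first alternative would make \<open>P\<close>
    small, so \<open>'k\<close> injects into \<open>P\<close>.\<close>
  moreover have "(\<exists>f :: 'k zfa \<Rightarrow> 'k. inj_on f P \<and> f ` P \<subseteq> UNIV) \<or>
      (\<exists>g :: 'k \<Rightarrow> 'k zfa. inj g \<and> g ` UNIV \<subseteq> P)"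
    unfolding card_of_ordLeq by (intro ordLeq_total card_of_Well_order)
  ultimately obtain g :: "'k \<Rightarrow> 'k zfa" where "g ` UNIV \<subseteq> P" "inj g"
    by blast
  then show ?thesis
    by (auto simp: P_def image_subset_iff)
qed

text \<open>Labels are invariant names for indices; as tags they carry types and constants without
  adding to the support.\<close>

definition label :: "'k \<Rightarrow> 'k zfa" where
  "label = (SOME g. inj g \<and> (\<forall>\<pi> k. zperm \<pi> (g k) = g k))"

lemma inj_label: "inj label" and zperm_label [simp]: "zperm \<pi> (label k) = label k"
  using someI_ex[OF invariant_labels] unfolding label_def by auto

lemma label_eq_iff [simp]: "label k = label l \<longleftrightarrow> k = l"
  by (rule inj_eq[OF inj_label])

lemma zset_eq_iff: "small X \<Longrightarrow> small Y \<Longrightarrow> zset X = zset Y \<longleftrightarrow> X = Y"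
  by (metis zelems_zset)

text \<open>The left summand supplies the tags and makes every set of coded raw terms small;
  \<open>'j\<close> stays arbitrary, so the model exists in every universe of at least that
  size.\<close>

type_synonym ('b, 'c, 'j) zterm = "(('b, 'c) raw_trm + 'j) zfa"

lemma small_doubleton [simp]:
  fixes x y :: "('b, 'c, 'j) zterm"
  shows "small {x, y}"
proof -
  define k l :: "('b, 'c) raw_trm + 'j" where "k = Inl (RVar (Atom 0))" and "l = Inl (RVar (Atom 1))"
  have "k \<noteq> l" by (simp add: k_def l_def)
  then have "{x, y} = (\<lambda>i. if i = k then x else y) ` {k, l}" by auto
  then show ?thesis unfolding small_def by (intro exI)
qed

lemma small_singleton [simp]: "small {x :: ('b, 'c, 'j) zterm}"
  using small_doubleton[of x x] by simp

text \<open>Kuratowski pairs, which are equivariant because permutations act elementwise.\<close>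

definition opair :: "('b, 'c, 'j) zterm \<Rightarrow> ('b, 'c, 'j) zterm \<Rightarrow> ('b, 'c, 'j) zterm" where
  "opair x y = zset {zset {x}, zset {x, y}}"

lemma opair_eq_iff [simp]: "opair x y = opair x' y' \<longleftrightarrow> x = x' \<and> y = y'"
  by (auto simp: opair_def zset_eq_iff doubleton_eq_iff)

lemma zperm_opair [simp]: "zperm \<pi> (opair x y) = opair (zperm \<pi> x) (zperm \<pi> y)"
  by (simp add: opair_def zperm_zset)

text \<open>The tag fixes the constructor together with its constant or type; \<open>Atom 0\<close>
  in tags is a placeholder. The atoms of the term, bound ones included, enter as
  \<open>zatom\<close>, so permutations act on codes as \<open>raw_perm\<close> acts on raw
  terms.\<close>

primrec zcode :: "('b, 'c) raw_trm \<Rightarrow> ('b, 'c, 'j) zterm" where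
  "zcode (RVar a) = opair (label (Inl (RVar (Atom 0)))) (zatom a)"
| "zcode (RCon C) = opair (label (Inl (RCon C))) (label (Inl (RCon C)))"
| "zcode (RLam a \<phi> r) =
     opair (label (Inl (RLam (Atom 0) \<phi> (RVar (Atom 0))))) (opair (zatom a) (zcode r))"
| "zcode (RApp r s) =
     opair (label (Inl (RApp (RVar (Atom 0)) (RVar (Atom 0))))) (opair (zcode r) (zcode s))"

lemma zcode_eq_iff [simp]: "zcode r = zcode s \<longleftrightarrow> r = s"
proof (induction r arbitrary: s)
  case (RVar a) show ?case by (cases s) auto
next
  case (RCon C) show ?case by (cases s) auto
next
  case (RLam a \<phi> r) then show ?case by (cases s) auto
next
  case (RApp r r') then show ?case by (cases s) auto
qed

lemma zperm_zcode [simp]: "zperm \<pi> (zcode r) = zcode (raw_perm \<pi> r)"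
  by (induction r) simp_all

definition zcode_set :: "('b, 'c) raw_trm set \<Rightarrow> ('b, 'c, 'j) zterm" where
  "zcode_set S = zset (zcode ` S)"

text \<open>The raw terms index their own codes through \<open>Inl\<close>.\<close>

lemma small_zcode_image: "small (zcode ` S :: ('b, 'c, 'j) zterm set)"
proof -
  have "(zcode ` S :: ('b, 'c, 'j) zterm set) = (\<lambda>k. zcode (projl k)) ` Inl ` S"
    by (simp add: image_image)
  then show ?thesis unfolding small_def by (intro exI)
qed

lemma zcode_set_eq_iff [simp]: "zcode_set S = zcode_set T \<longleftrightarrow> S = T"
proof -
  have "inj zcode" by (simp add: inj_def)
  from inj_image_eq_iff[OF this] show ?thesis
    by (simp add: zcode_set_def zset_eq_iff small_zcode_image)
qed

lemma zperm_zcode_set: "zperm \<pi> (zcode_set S) = zcode_set (raw_perm \<pi> ` S)"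
  by (simp add: zcode_set_def zperm_zset small_zcode_image image_image)

section \<open>Free atoms up to \<open>\<beta>\<close>-equality\<close>

lemma tperm_one [simp]: "tperm 1 r = r"
  by transfer (simp add: alpha_refl)

lemma tperm_tperm: "tperm \<pi> (tperm \<rho> r) = tperm (\<pi> * \<rho>) r"
  by transfer (simp add: raw_perm_perm alpha_refl)

lemma finite_fv [simp]: "finite (fv r)"
  by transfer simp

lemma fv_tperm: "fv (tperm \<pi> r) = (\<lambda>a. \<pi> \<langle>$\<rangle> a) ` fv r"
  by transfer (rule raw_fv_perm)

lemma tperm_fresh: "(\<And>a. a \<in> fv r \<Longrightarrow> \<pi> \<langle>$\<rangle> a = a) \<Longrightarrow> tperm \<pi> r = r"
proof transfer
  fix r :: "('a, 'b) raw_trm" and \<pi>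
  assume "\<And>a. a \<in> raw_fv r \<Longrightarrow> \<pi> \<langle>$\<rangle> a = a"
  then have "alpha (raw_perm \<pi> r) (raw_perm 1 r)" by (intro alpha_perm_cong) simp
  then show "alpha (raw_perm \<pi> r) r" by simp
qed

lemma subst_fresh: "a \<notin> fv r \<Longrightarrow> r[a ::= t] = r"
proof transfer
  fix r t :: "('a, 'b) raw_trm" and a
  assume "a \<notin> raw_fv r"
  then have "raw_subst (RVar(a := t)) r = raw_subst RVar r" by (intro raw_subst_cong) auto
  then show "alpha (raw_subst (RVar(a := t)) r) r" by (simp add: alpha_canonical alpha_sym)
qed

lemma tperm_subst: "tperm \<pi> (r[a ::= t]) = (tperm \<pi> r)[\<pi> \<langle>$\<rangle> a ::= tperm \<pi> t]"
proof transfer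
  fix \<pi> and r t :: "('a, 'b) raw_trm" and a
  \<comment> \<open>Both sides amount to this one substitution applied to \<open>r\<close>: on the
    left by \<open>raw_perm_subst\<close>, on the right by \<open>raw_subst_perm\<close>.\<close>
  have "(\<lambda>b. raw_perm \<pi> ((RVar(a := t)) b)) = (\<lambda>b. (RVar(\<pi> \<langle>$\<rangle> a := raw_perm \<pi> t)) (\<pi> \<langle>$\<rangle> b))"
    by (auto simp: apply_inj)
  then show "alpha (raw_perm \<pi> (raw_subst (RVar(a := t)) r))
      (raw_subst (RVar(\<pi> \<langle>$\<rangle> a := raw_perm \<pi> t)) (raw_perm \<pi> r))"
    using raw_perm_subst[of \<pi> "RVar(a := t)" r] by (simp only: raw_subst_perm)
qed

lemma beta_eq_tperm: "r =\<^sub>\<beta> s \<Longrightarrow> tperm \<pi> r =\<^sub>\<beta> tperm \<pi> s"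
proof (induction rule: beta_eq.induct)
  case (beta_trans r s t)
  then show ?case by (blast intro: beta_eq.beta_trans)
qed (auto simp: tperm_subst intro: beta_eq.intros)

text \<open>Taking an intersection avoids looking for a term of the class with fewest free atoms.
  Each atom outside it is missing from some term of the class, and the arguments below treat one
  atom at a time.\<close>

definition beta_fv :: "('b, 'c) trm \<Rightarrow> atom set" where
  "beta_fv r = \<Inter>{fv s | s. s =\<^sub>\<beta> r}"

lemma beta_fv_subset: "beta_fv r \<subseteq> fv r"
  unfolding beta_fv_def using beta_refl by blast

lemma beta_fv_cong:
  assumes "r =\<^sub>\<beta> s"
  shows "beta_fv r = beta_fv s"
proof -
  have "t =\<^sub>\<beta> r \<longleftrightarrow> t =\<^sub>\<beta> s" for t
    using assms by (meson beta_sym beta_trans)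
  then show ?thesis by (simp add: beta_fv_def)
qed

lemma not_in_beta_fvE:
  assumes "a \<notin> beta_fv r"
  obtains s where "s =\<^sub>\<beta> r" "a \<notin> fv s"
  using assms by (auto simp: beta_fv_def)

lemma not_in_beta_fvI: "s =\<^sub>\<beta> r \<Longrightarrow> a \<notin> fv s \<Longrightarrow> a \<notin> beta_fv r"
  by (auto simp: beta_fv_def)

text \<open>Representatives of \<open>r\<close> and \<open>s\<close> that both avoid a given atom
  combine to one of \<open>App r s\<close>. Equality is not claimed, since contracting a redex may
  discard its argument.\<close>

lemma beta_fv_App: "beta_fv (App r s) \<subseteq> beta_fv r \<union> beta_fv s"
proof (rule subsetI, rule ccontr)
  fix a
  assume a: "a \<in> beta_fv (App r s)" "a \<notin> beta_fv r \<union> beta_fv s"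
  then obtain r' s' where "r' =\<^sub>\<beta> r" "s' =\<^sub>\<beta> s" and fv: "a \<notin> fv r'" "a \<notin> fv s'"
    by (auto elim!: not_in_beta_fvE)
  from this(1,2) have "App r' s' =\<^sub>\<beta> App r s" by (rule beta_App)
  then have "a \<notin> beta_fv (App r s)"
    by (rule not_in_beta_fvI) (simp add: fv)
  with a show False by blast
qed

lemma beta_fv_Lam: "beta_fv (Lam a \<phi> r) \<subseteq> beta_fv r - {a}"
proof (rule subsetI, rule ccontr)
  fix b
  assume b: "b \<in> beta_fv (Lam a \<phi> r)" "b \<notin> beta_fv r - {a}"
  moreover have "b \<noteq> a"
    using b(1) beta_fv_subset[of "Lam a \<phi> r"] by auto
  ultimately obtain r' where "r' =\<^sub>\<beta> r" "b \<notin> fv r'"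
    by (auto elim: not_in_beta_fvE)
  then have "b \<notin> beta_fv (Lam a \<phi> r)"
    by (intro not_in_beta_fvI[OF beta_Lam]) auto
  with b show False by blast
qed

text \<open>A representative of \<open>tperm \<pi> r\<close> is pulled back along
  \<open>inverse \<pi>\<close> to one of \<open>r\<close>. The converse is this inclusion for
  \<open>inverse \<pi>\<close>; \<open>raw_elt_perm\<close> and \<open>term_carrier_perm\<close>
  repeat the pattern.\<close>

lemma beta_fv_tperm_subset: "(\<lambda>a. \<pi> \<langle>$\<rangle> a) ` beta_fv r \<subseteq> beta_fv (tperm \<pi> r)"
proof (rule image_subsetI, rule ccontr)
  fix a
  assume "a \<in> beta_fv r" "\<pi> \<langle>$\<rangle> a \<notin> beta_fv (tperm \<pi> r)"
  then obtain s where s: "s =\<^sub>\<beta> tperm \<pi> r" "\<pi> \<langle>$\<rangle> a \<notin> fv s"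
    by (auto elim: not_in_beta_fvE)
  have "tperm (inverse \<pi>) s =\<^sub>\<beta> r"
    using beta_eq_tperm[OF s(1), of "inverse \<pi>"] by (simp add: tperm_tperm)
  moreover have "a \<notin> fv (tperm (inverse \<pi>) s)"
  proof
    assume "a \<in> fv (tperm (inverse \<pi>) s)"
    then obtain b where "b \<in> fv s" "a = inverse \<pi> \<langle>$\<rangle> b" by (auto simp: fv_tperm)
    then have "\<pi> \<langle>$\<rangle> a = (\<pi> * inverse \<pi>) \<langle>$\<rangle> b" by (simp only: apply_times o_apply)
    with \<open>b \<in> fv s\<close> s(2) show False by simp
  qed
  ultimately show False
    using \<open>a \<in> beta_fv r\<close> not_in_beta_fvI by blast
qed

lemma beta_fv_tperm: "beta_fv (tperm \<pi> r) = (\<lambda>a. \<pi> \<langle>$\<rangle> a) ` beta_fv r"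
proof
  show "beta_fv (tperm \<pi> r) \<subseteq> (\<lambda>a. \<pi> \<langle>$\<rangle> a) ` beta_fv r"
  proof
    fix a
    assume "a \<in> beta_fv (tperm \<pi> r)"
    then have "inverse \<pi> \<langle>$\<rangle> a \<in> beta_fv (tperm (inverse \<pi>) (tperm \<pi> r))"
      using beta_fv_tperm_subset by blast
    then have "inverse \<pi> \<langle>$\<rangle> a \<in> beta_fv r" by (simp add: tperm_tperm)
    moreover have "a = (\<pi> * inverse \<pi>) \<langle>$\<rangle> a" by simp
    then have "a = \<pi> \<langle>$\<rangle> (inverse \<pi> \<langle>$\<rangle> a)" by (simp only: apply_times o_apply)
    ultimately show "a \<in> (\<lambda>a. \<pi> \<langle>$\<rangle> a) ` beta_fv r" by blast
  qed
qed (rule beta_fv_tperm_subset)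

section \<open>The term model\<close>

definition env_on :: "'b env \<Rightarrow> atom set \<Rightarrow> 'b env" where
  "env_on \<Gamma> A = {(a, \<phi>) \<in> \<Gamma>. a \<in> A}"

text \<open>The two kinds of members, applications and abstractions, keep the class of \<open>t\<close> apart from
  the typings of its free atoms.\<close>

definition raw_elt :: "'b env \<Rightarrow> ('b, 'c) trm \<Rightarrow> ('b, 'c) raw_trm set" where
  "raw_elt \<Gamma> t = {RApp r r | r. abs_trm r =\<^sub>\<beta> t} \<union>
     (\<lambda>(a, \<phi>). RLam a \<phi> (RVar a)) ` env_on \<Gamma> (beta_fv t)"

definition elt :: "'b env \<Rightarrow> ('b, 'c) trm \<Rightarrow> ('b, 'c, 'j) zterm" where
  "elt \<Gamma> t = zcode_set (raw_elt \<Gamma> t)"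

lemma raw_elt_eq_iff:
  "raw_elt \<Gamma> t = raw_elt \<Delta> u \<longleftrightarrow> t =\<^sub>\<beta> u \<and> env_on \<Gamma> (beta_fv t) = env_on \<Delta> (beta_fv u)"
proof
  \<comment> \<open>Both components can be read off from the set: the class from its applications,
    the typings from its abstractions.\<close>
  have app: "RApp r r \<in> raw_elt \<Gamma> t \<longleftrightarrow> abs_trm r =\<^sub>\<beta> t" for r and \<Gamma> :: "'a env" and t :: "('a, 'b) trm"
    by (auto simp: raw_elt_def)
  have lam: "RLam a \<phi> (RVar a) \<in> raw_elt \<Gamma> t \<longleftrightarrow> (a, \<phi>) \<in> env_on \<Gamma> (beta_fv t)"
    for a \<phi> and \<Gamma> :: "'a env" and t :: "('a, 'b) trm"
    by (force simp: raw_elt_def)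
  assume eq: "raw_elt \<Gamma> t = raw_elt \<Delta> u"
  have "t = abs_trm (rep_trm t)"
    by (simp only: Quotient_abs_rep[OF Quotient_trm])
  then have "t =\<^sub>\<beta> u"
    using app[of "rep_trm t" \<Gamma> t] app[of "rep_trm t" \<Delta> u] beta_refl by (simp add: eq)
  moreover have "p \<in> env_on \<Gamma> (beta_fv t) \<longleftrightarrow> p \<in> env_on \<Delta> (beta_fv u)" for p
    using lam[of "fst p" "snd p" \<Gamma> t] lam[of "fst p" "snd p" \<Delta> u] by (simp add: eq)
  ultimately show "t =\<^sub>\<beta> u \<and> env_on \<Gamma> (beta_fv t) = env_on \<Delta> (beta_fv u)"
    by blast
next
  assume *: "t =\<^sub>\<beta> u \<and> env_on \<Gamma> (beta_fv t) = env_on \<Delta> (beta_fv u)"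
  then have "r =\<^sub>\<beta> t \<longleftrightarrow> r =\<^sub>\<beta> u" for r
    by (meson beta_sym beta_trans)
  with * show "raw_elt \<Gamma> t = raw_elt \<Delta> u"
    by (simp add: raw_elt_def)
qed

lemma elt_eq_iff:
  "elt \<Gamma> t = elt \<Delta> u \<longleftrightarrow> t =\<^sub>\<beta> u \<and> env_on \<Gamma> (beta_fv t) = env_on \<Delta> (beta_fv u)"
  by (simp add: elt_def raw_elt_eq_iff)

lemma elt_cong: "t =\<^sub>\<beta> u \<Longrightarrow> elt \<Gamma> t = elt \<Gamma> u"
  by (simp add: elt_eq_iff beta_fv_cong)

lemma elt_env_cong:
  "(\<And>a \<phi>. a \<in> beta_fv t \<Longrightarrow> (a, \<phi>) \<in> \<Gamma> \<longleftrightarrow> (a, \<phi>) \<in> \<Delta>) \<Longrightarrow> elt \<Gamma> t = elt \<Delta> t"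
  by (auto simp: elt_eq_iff env_on_def beta_refl)

text \<open>This is how the typing of a bound atom disappears: by \<open>beta_fv_Lam\<close> the
  atom lies outside \<open>beta_fv\<close> of the abstraction.\<close>

lemma elt_insert: "a \<notin> beta_fv t \<Longrightarrow> elt (insert (a, \<phi>) \<Gamma>) t = elt \<Gamma> t"
  by (rule elt_env_cong) auto

section \<open>Permutation action and support of elements\<close>

lemma raw_elt_perm_subset: "raw_perm \<pi> ` raw_elt \<Gamma> t \<subseteq> raw_elt (env_perm \<pi> \<Gamma>) (tperm \<pi> t)"
proof (rule image_subsetI)
  fix r
  assume "r \<in> raw_elt \<Gamma> t"
  then consider s where "r = RApp s s" "abs_trm s =\<^sub>\<beta> t"
    | a \<phi> where "r = RLam a \<phi> (RVar a)" "(a, \<phi>) \<in> \<Gamma>" "a \<in> beta_fv t"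
    by (auto simp: raw_elt_def env_on_def)
  then show "raw_perm \<pi> r \<in> raw_elt (env_perm \<pi> \<Gamma>) (tperm \<pi> t)"
  proof cases
    case 1
    then show ?thesis
      using beta_eq_tperm[OF 1(2), of \<pi>] by (simp add: raw_elt_def tperm.abs_eq)
  next
    case 2
    then have "(\<pi> \<langle>$\<rangle> a, \<phi>) \<in> env_on (env_perm \<pi> \<Gamma>) (beta_fv (tperm \<pi> t))"
      by (force simp: env_on_def env_perm_def beta_fv_tperm)
    then show ?thesis
      unfolding raw_elt_def 2 by force
  qed
qed

lemma env_perm_one [simp]: "env_perm 1 \<Gamma> = \<Gamma>"
  by (force simp: env_perm_def)

lemma env_perm_env_perm: "env_perm \<pi> (env_perm \<rho> \<Gamma>) = env_perm (\<pi> * \<rho>) \<Gamma>"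
  by (force simp: env_perm_def image_image apply_times case_prod_unfold)

lemma raw_elt_perm: "raw_perm \<pi> ` raw_elt \<Gamma> t = raw_elt (env_perm \<pi> \<Gamma>) (tperm \<pi> t)"
proof
  let ?S = "raw_elt (env_perm \<pi> \<Gamma>) (tperm \<pi> t)"
  have "raw_perm (inverse \<pi>) ` ?S \<subseteq> raw_elt \<Gamma> t"
    using raw_elt_perm_subset[of "inverse \<pi>" "env_perm \<pi> \<Gamma>" "tperm \<pi> t"]
    by (simp add: env_perm_env_perm tperm_tperm)
  then have "raw_perm \<pi> ` raw_perm (inverse \<pi>) ` ?S \<subseteq> raw_perm \<pi> ` raw_elt \<Gamma> t"
    by (rule image_mono)
  then show "?S \<subseteq> raw_perm \<pi> ` raw_elt \<Gamma> t"
    by (simp add: image_image raw_perm_perm)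
qed (rule raw_elt_perm_subset)

lemma zperm_elt: "zperm \<pi> (elt \<Gamma> t) = elt (env_perm \<pi> \<Gamma>) (tperm \<pi> t)"
  by (simp add: elt_def zperm_zcode_set raw_elt_perm)

text \<open>If some \<open>u\<close> in the class avoids \<open>a\<close>, then \<open>fv u\<close>
  is a finite support without \<open>a\<close>. Conversely, if a finite support omits
  \<open>a\<close>, swapping \<open>a\<close> with a fresh atom preserves the class and turns
  \<open>t\<close> into a member that avoids \<open>a\<close>.\<close>

lemma supp_elt: "supp zperm (elt \<Gamma> t :: ('b, 'c, 'j) zterm) = beta_fv t"
proof (intro equalityI subsetI)
  fix a
  assume a: "a \<in> supp zperm (elt \<Gamma> t :: ('b, 'c, 'j) zterm)"
  show "a \<in> beta_fv t"
  proof (rule ccontr)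
    assume "a \<notin> beta_fv t"
    then obtain u where u: "u =\<^sub>\<beta> t" "a \<notin> fv u" by (rule not_in_beta_fvE)
    have eq: "elt \<Gamma> t = (elt \<Gamma> u :: ('b, 'c, 'j) zterm)"
      using u(1) by (metis elt_cong)
    have "supports zperm (fv u) (elt \<Gamma> u :: ('b, 'c, 'j) zterm)"
      unfolding supports_def
    proof (intro allI impI)
      fix \<pi>
      assume \<pi>: "\<forall>b\<in>fv u. \<pi> \<langle>$\<rangle> b = b"
      \<comment> \<open>\<open>\<pi>\<close> may change \<open>\<Gamma>\<close>, but not the typings
        of atoms in \<open>fv u\<close>, which include all those recorded.\<close>
      have "elt (env_perm \<pi> \<Gamma>) u = (elt \<Gamma> u :: ('b, 'c, 'j) zterm)"
      proof (rule elt_env_cong)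
        fix b \<phi>
        assume "b \<in> beta_fv u"
        then have "b \<in> fv u" using beta_fv_subset by blast
        then have b: "\<pi> \<langle>$\<rangle> b = b" using \<pi> by blast
        show "(b, \<phi>) \<in> env_perm \<pi> \<Gamma> \<longleftrightarrow> (b, \<phi>) \<in> \<Gamma>"
        proof
          assume "(b, \<phi>) \<in> env_perm \<pi> \<Gamma>"
          then obtain d where d: "b = \<pi> \<langle>$\<rangle> d" "(d, \<phi>) \<in> \<Gamma>" by (auto simp: env_perm_def)
          then have "d = b" using b by (metis apply_inj)
          with d show "(b, \<phi>) \<in> \<Gamma>" by simp
        next
          assume "(b, \<phi>) \<in> \<Gamma>"
          then show "(b, \<phi>) \<in> env_perm \<pi> \<Gamma>" using b by (force simp: env_perm_def)
        qed
      qed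
      then show "zperm \<pi> (elt \<Gamma> u :: ('b, 'c, 'j) zterm) = elt \<Gamma> u"
        using \<pi> by (simp add: zperm_elt tperm_fresh)
    qed
    then have "supp zperm (elt \<Gamma> u :: ('b, 'c, 'j) zterm) \<subseteq> fv u"
      by (auto simp: supp_def)
    with a u(2) show False by (auto simp: eq)
  qed
next
  fix a
  assume a: "a \<in> beta_fv t"
  show "a \<in> supp zperm (elt \<Gamma> t :: ('b, 'c, 'j) zterm)"
    unfolding supp_def
  proof (rule InterI, rule ccontr)
    fix A
    assume "A \<in> {A. finite A \<and> supports zperm A (elt \<Gamma> t :: ('b, 'c, 'j) zterm)}" and aA: "a \<notin> A"
    then have A: "finite A" "supports zperm A (elt \<Gamma> t :: ('b, 'c, 'j) zterm)" by auto
    define b where "b = fresh_atom (A \<union> fv t \<union> {a})"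
    have b: "b \<notin> A \<union> fv t \<union> {a}" unfolding b_def by (rule fresh_atom) (simp add: A)
    have "\<forall>d\<in>A. \<langle>a \<leftrightarrow> b\<rangle> \<langle>$\<rangle> d = d" using aA b by (metis UnCI apply_swap_same)
    then have "zperm \<langle>a \<leftrightarrow> b\<rangle> (elt \<Gamma> t :: ('b, 'c, 'j) zterm) = elt \<Gamma> t"
      using A(2) by (simp add: supports_def)
    then have "tperm \<langle>a \<leftrightarrow> b\<rangle> t =\<^sub>\<beta> t"
      by (simp add: zperm_elt elt_eq_iff)
    moreover have "a \<notin> fv (tperm \<langle>a \<leftrightarrow> b\<rangle> t)"
    proof
      assume "a \<in> fv (tperm \<langle>a \<leftrightarrow> b\<rangle> t)"
      then obtain d where "d \<in> fv t" "a = \<langle>a \<leftrightarrow> b\<rangle> \<langle>$\<rangle> d" by (auto simp: fv_tperm)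
      with b show False by (cases "d = a"; cases "d = b") auto
    qed
    ultimately show False using a not_in_beta_fvI by blast
  qed
qed

section \<open>Abstraction and application of elements\<close>

definition elt_abs :: "atom \<Rightarrow> 'b ty \<Rightarrow> ('b, 'c, 'j) zterm \<Rightarrow> ('b, 'c, 'j) zterm" where
  "elt_abs a \<phi> x = (THE y. \<exists>\<Gamma> t. x = elt \<Gamma> t \<and> y = elt \<Gamma> (Lam a \<phi> t))"

text \<open>The operations of an interpretation receive no environment, so, as in
  \<open>elt_abs\<close>, terms and environment are recovered from the elements; here both arguments
  must be presented over one common environment.\<close>

definition elt_app :: "('b, 'c, 'j) zterm \<Rightarrow> ('b, 'c, 'j) zterm \<Rightarrow> ('b, 'c, 'j) zterm" where
  "elt_app x y = (THE z. \<exists>\<Gamma> t u. x = elt \<Gamma> t \<and> y = elt \<Gamma> u \<and> z = elt \<Gamma> (App t u))"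

lemma env_on_mono: "env_on \<Gamma> A = env_on \<Delta> A \<Longrightarrow> B \<subseteq> A \<Longrightarrow> env_on \<Gamma> B = env_on \<Delta> B"
  by (auto simp: env_on_def set_eq_iff)

text \<open>Two presentations of an element agree on the typings of \<open>beta_fv t\<close>, and
  abstraction only shrinks that set, so the results agree as well.\<close>

lemma elt_abs_elt [simp]: "elt_abs a \<phi> (elt \<Gamma> t) = elt \<Gamma> (Lam a \<phi> t)"
  unfolding elt_abs_def
proof (rule the_equality)
  fix y :: "('a, 'b, 'c) zterm"
  assume "\<exists>\<Delta> u. (elt \<Gamma> t :: ('a, 'b, 'c) zterm) = elt \<Delta> u \<and> y = elt \<Delta> (Lam a \<phi> u)"
  then obtain \<Delta> u where tu: "t =\<^sub>\<beta> u" and env: "env_on \<Gamma> (beta_fv t) = env_on \<Delta> (beta_fv u)"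
    and y: "y = elt \<Delta> (Lam a \<phi> u)"
    by (auto simp: elt_eq_iff)
  have lam: "Lam a \<phi> t =\<^sub>\<beta> Lam a \<phi> u" by (rule beta_Lam[OF tu])
  have "env_on \<Gamma> (beta_fv (Lam a \<phi> t)) = env_on \<Delta> (beta_fv (Lam a \<phi> t))"
    by (rule env_on_mono[of _ "beta_fv t"]) (use env beta_fv_cong[OF tu] beta_fv_Lam[of a \<phi> t] in auto)
  then show "y = elt \<Gamma> (Lam a \<phi> t)"
    using lam beta_fv_cong[OF lam] by (simp add: y elt_eq_iff beta_sym)
qed blast

lemma elt_app_elt [simp]: "elt_app (elt \<Gamma> t) (elt \<Gamma> u) = elt \<Gamma> (App t u)"
  unfolding elt_app_def
proof (rule the_equality)
  fix z :: "('a, 'b, 'c) zterm"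
  assume "\<exists>\<Delta> t' u'. (elt \<Gamma> t :: ('a, 'b, 'c) zterm) = elt \<Delta> t' \<and>
      (elt \<Gamma> u :: ('a, 'b, 'c) zterm) = elt \<Delta> u' \<and> z = elt \<Delta> (App t' u')"
  then obtain \<Delta> t' u' where tu: "t =\<^sub>\<beta> t'" "u =\<^sub>\<beta> u'"
    and env: "env_on \<Gamma> (beta_fv t) = env_on \<Delta> (beta_fv t')" "env_on \<Gamma> (beta_fv u) = env_on \<Delta> (beta_fv u')"
    and z: "z = elt \<Delta> (App t' u')"
    by (auto simp: elt_eq_iff)
  have app: "App t u =\<^sub>\<beta> App t' u'" by (rule beta_App[OF tu])
  have "env_on \<Gamma> (beta_fv t \<union> beta_fv u) = env_on \<Delta> (beta_fv t \<union> beta_fv u)"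
    using env unfolding beta_fv_cong[OF tu(1)] beta_fv_cong[OF tu(2)]
    by (auto simp: env_on_def set_eq_iff)
  then have "env_on \<Gamma> (beta_fv (App t u)) = env_on \<Delta> (beta_fv (App t u))"
    by (rule env_on_mono) (rule beta_fv_App)
  then show "z = elt \<Gamma> (App t u)"
    using app beta_fv_cong[OF app] by (simp add: z elt_eq_iff beta_sym)
qed blast

section \<open>Carriers\<close>

definition term_carrier :: "'b env \<Rightarrow> ('b, 'c, 'j) zterm set" where
  "term_carrier \<Gamma> = {elt \<Gamma> t | t. beta_fv t \<subseteq> Domain \<Gamma>}"

text \<open>\<open>var_el\<close> and \<open>con_el\<close> receive no environment, so the smallest
  possible one is used; \<open>elt_Var\<close> and \<open>elt_Con\<close> transfer the result to any
  suitable \<open>\<Gamma>\<close>.\<close>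

definition term_model :: "('b, 'c, ('b, 'c) raw_trm + 'j) interp" where
  "term_model = \<lparr>carrier = \<lambda>\<Gamma> \<phi>. term_carrier \<Gamma>, var_el = \<lambda>a \<phi>. elt {(a, \<phi>)} (Var a),
     con_el = \<lambda>C. elt {} (Con C), abs_el = elt_abs, app_el = elt_app\<rparr>"

lemma term_model_simps [simp]:
  "carrier term_model \<Gamma> \<phi> = term_carrier \<Gamma>"
  "var_el term_model a \<phi> = elt {(a, \<phi>)} (Var a)"
  "con_el term_model C = elt {} (Con C)"
  "abs_el term_model = elt_abs"
  "app_el term_model = elt_app"
  by (simp_all add: term_model_def)

lemma elt_Var: "is_env \<Gamma> \<Longrightarrow> (a, \<phi>) \<in> \<Gamma> \<Longrightarrow> elt {(a, \<phi>)} (Var a) = elt \<Gamma> (Var a)"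
proof (rule elt_env_cong)
  fix b \<psi>
  assume env: "is_env \<Gamma>" and a: "(a, \<phi>) \<in> \<Gamma>" and b: "b \<in> beta_fv (Var a)"
  have "b = a" using subsetD[OF beta_fv_subset b] by simp
  then show "(b, \<psi>) \<in> {(a, \<phi>)} \<longleftrightarrow> (b, \<psi>) \<in> \<Gamma>"
    using a is_envD[OF env a, of \<psi>] by blast
qed

lemma elt_Con: "elt {} (Con C) = elt \<Gamma> (Con C)"
  by (rule elt_env_cong) (use beta_fv_subset[of "Con C"] in auto)

lemma elt_in_term_carrier: "beta_fv t \<subseteq> Domain \<Gamma> \<Longrightarrow> elt \<Gamma> t \<in> term_carrier \<Gamma>"
  by (auto simp: term_carrier_def)

lemma term_carrierE:
  assumes "x \<in> term_carrier \<Gamma>"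
  obtains t where "x = elt \<Gamma> t" "beta_fv t \<subseteq> Domain \<Gamma>"
  using assms unfolding term_carrier_def by blast

lemma term_carrier_perm_subset: "zperm \<pi> ` term_carrier \<Gamma> \<subseteq> term_carrier (env_perm \<pi> \<Gamma>)"
proof (rule image_subsetI)
  fix x
  assume "x \<in> term_carrier \<Gamma>"
  then obtain t where x: "x = elt \<Gamma> t" and t: "beta_fv t \<subseteq> Domain \<Gamma>" by (rule term_carrierE)
  have "beta_fv (tperm \<pi> t) \<subseteq> Domain (env_perm \<pi> \<Gamma>)"
    unfolding beta_fv_tperm Domain_env_perm by (rule image_mono[OF t])
  then show "zperm \<pi> x \<in> term_carrier (env_perm \<pi> \<Gamma>)"
    by (simp add: x zperm_elt elt_in_term_carrier)
qed

lemma term_carrier_perm: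
  "zperm \<pi> ` term_carrier \<Gamma> = (term_carrier (env_perm \<pi> \<Gamma>) :: ('b, 'c, 'j) zterm set)"
proof
  let ?S = "term_carrier (env_perm \<pi> \<Gamma>) :: ('b, 'c, 'j) zterm set"
  have "zperm (inverse \<pi>) ` ?S \<subseteq> term_carrier \<Gamma>"
    using term_carrier_perm_subset[of "inverse \<pi>" "env_perm \<pi> \<Gamma>"] by (simp add: env_perm_env_perm)
  then have "zperm \<pi> ` zperm (inverse \<pi>) ` ?S \<subseteq> zperm \<pi> ` term_carrier \<Gamma>"
    by (rule image_mono)
  moreover have "zperm \<pi> (zperm (inverse \<pi>) x) = x" for x :: "('b, 'c, 'j) zterm"
    using zperm_times[of \<pi> "inverse \<pi>" x] by (simp add: zperm_one)
  ultimately show "?S \<subseteq> zperm \<pi> ` term_carrier \<Gamma>"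
    by (simp add: image_image)
qed (rule term_carrier_perm_subset)

lemma term_carrier_mono:
  assumes "is_env \<Delta>" "\<Gamma> \<subseteq> \<Delta>"
  shows "term_carrier \<Gamma> \<subseteq> term_carrier \<Delta>"
proof
  fix x
  assume "x \<in> term_carrier \<Gamma>"
  then obtain t where x: "x = elt \<Gamma> t" and t: "beta_fv t \<subseteq> Domain \<Gamma>" by (rule term_carrierE)
  have "x = elt \<Delta> t"
    unfolding x
  proof (rule elt_env_cong)
    fix a \<phi>
    assume "a \<in> beta_fv t"
    then obtain \<psi> where "(a, \<psi>) \<in> \<Gamma>" using t by blast
    \<comment> \<open>Functionality of \<open>\<Delta>\<close> excludes a second type for an atom
      typed in \<open>\<Gamma>\<close>.\<close>
    then show "(a, \<phi>) \<in> \<Gamma> \<longleftrightarrow> (a, \<phi>) \<in> \<Delta>"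
      using assms(2) is_envD[OF assms(1)] by blast
  qed
  moreover have "beta_fv t \<subseteq> Domain \<Delta>" using t assms(2) by blast
  ultimately show "x \<in> term_carrier \<Delta>" by (simp add: elt_in_term_carrier)
qed

text \<open>An element of both carriers records the same typings from \<open>\<Gamma>\<close> and
  \<open>\<Delta>\<close>, so these lie in the intersection. Since \<open>term_carrier\<close>
  bounds \<open>beta_fv\<close>, an invariant of the class, the representative \<open>t\<close> from
  one side serves for both.\<close>

lemma term_carrier_Int:
  assumes "is_env \<Gamma>" "is_env \<Delta>"
  shows "term_carrier (\<Gamma> \<inter> \<Delta>) = term_carrier \<Gamma> \<inter> term_carrier \<Delta>"
proof (intro equalityI subsetI)
  fix x
  assume "x \<in> term_carrier (\<Gamma> \<inter> \<Delta>)"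
  then show "x \<in> term_carrier \<Gamma> \<inter> term_carrier \<Delta>"
    using term_carrier_mono[OF assms(1), of "\<Gamma> \<inter> \<Delta>"] term_carrier_mono[OF assms(2), of "\<Gamma> \<inter> \<Delta>"] by auto
next
  fix x
  assume "x \<in> term_carrier \<Gamma> \<inter> term_carrier \<Delta>"
  then obtain t u where x: "x = elt \<Gamma> t" "x = elt \<Delta> u" and t: "beta_fv t \<subseteq> Domain \<Gamma>"
    by (metis IntD1 IntD2 term_carrierE)
  have "t =\<^sub>\<beta> u" "env_on \<Gamma> (beta_fv t) = env_on \<Delta> (beta_fv u)"
    using elt_eq_iff x by metis+
  then have "env_on \<Gamma> (beta_fv t) = env_on \<Delta> (beta_fv t)"
    by (simp add: beta_fv_cong)
  then have env: "(a, \<phi>) \<in> \<Gamma> \<longleftrightarrow> (a, \<phi>) \<in> \<Delta>" if "a \<in> beta_fv t" for a \<phi>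
    using that by (auto simp: env_on_def set_eq_iff)
  have "x = elt (\<Gamma> \<inter> \<Delta>) t"
    unfolding x(1) by (rule elt_env_cong) (simp add: env)
  moreover have "beta_fv t \<subseteq> Domain (\<Gamma> \<inter> \<Delta>)"
    using t env by blast
  ultimately show "x \<in> term_carrier (\<Gamma> \<inter> \<Delta>)"
    by (simp add: elt_in_term_carrier)
qed

section \<open>Axioms of a nominal model\<close>

lemma subst_el_term_model:
  assumes "a \<notin> Domain \<Gamma>"
  shows "subst_el term_model a \<phi> (elt (insert (a, \<phi>) \<Gamma>) t) (elt \<Gamma> u) = elt \<Gamma> (t[a ::= u])"
proof -
  \<comment> \<open>This moves the abstraction to \<open>\<Gamma>\<close>, the environment of the
    argument; the application is then the class of a redex.\<close>
  have "a \<notin> beta_fv (Lam a \<phi> t)"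
    using beta_fv_Lam by blast
  then show ?thesis by (simp add: subst_el_def elt_insert elt_cong[OF beta_redex])
qed

text \<open>Equivariance: a permutation fixing \<open>Domain \<Gamma>\<close> pointwise fixes
  \<open>\<Gamma>\<close>, hence its carrier.\<close>

lemma finitely_supported_term_carrier:
  assumes "is_env \<Gamma>"
  shows "finitely_supported (\<lambda>\<pi>. (`) (zperm \<pi>)) (term_carrier \<Gamma> :: ('b, 'c, 'j) zterm set)"
  unfolding finitely_supported_def supports_def
proof (intro exI conjI allI impI)
  show "finite (Domain \<Gamma>)"
    using assms by (simp add: is_env_def finite_Domain)
  fix \<pi>
  assume "\<forall>a\<in>Domain \<Gamma>. \<pi> \<langle>$\<rangle> a = a"
  then have "env_perm \<pi> \<Gamma> = id ` \<Gamma>"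
    unfolding env_perm_def by (intro image_cong) auto
  then show "zperm \<pi> ` term_carrier \<Gamma> = (term_carrier \<Gamma> :: ('b, 'c, 'j) zterm set)"
    by (simp add: term_carrier_perm)
qed

lemma term_model_sub_abs:
  assumes "a \<notin> Domain \<Gamma>" "c \<notin> Domain \<Gamma>" "a \<noteq> c" "x \<in> term_carrier \<Gamma>"
    and "z \<in> term_carrier (insert (c, \<chi>) (insert (a, \<phi>) \<Gamma>))"
  shows "subst_el term_model a \<phi> (elt_abs c \<chi> z) x = elt_abs c \<chi> (subst_el term_model a \<phi> z x)"
proof -
  obtain t where z: "z = elt (insert (c, \<chi>) (insert (a, \<phi>) \<Gamma>)) t"
    using assms(5) by (rule term_carrierE)
  obtain u where x: "x = elt \<Gamma> u" "beta_fv u \<subseteq> Domain \<Gamma>"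
    using assms(4) by (rule term_carrierE)
  \<comment> \<open>\<open>u\<close> itself may contain \<open>c\<close> free; a representative
    \<open>v\<close> without \<open>c\<close> lets the substitution pass under the binder.\<close>
  have "c \<notin> beta_fv u" using x(2) assms(2) by blast
  then obtain v where v: "v =\<^sub>\<beta> u" "c \<notin> fv v" by (rule not_in_beta_fvE)
  have xv: "x = elt \<Gamma> v" unfolding x(1) by (rule elt_cong[OF v(1), symmetric])
  have cLam: "c \<notin> beta_fv (Lam c \<chi> t)" for t
    using beta_fv_Lam by blast
  have "c \<notin> beta_fv v" using v(2) beta_fv_subset by blast
  \<comment> \<open>The inner substitution on the right-hand side happens below \<open>c\<close>, so
    \<open>x\<close> is also presented over the environment extended by \<open>c\<close>.\<close>
  then have xv': "x = elt (insert (c, \<chi>) \<Gamma>) v" by (simp add: xv elt_insert)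
  have "subst_el term_model a \<phi> (elt_abs c \<chi> z) x
      = subst_el term_model a \<phi> (elt (insert (a, \<phi>) \<Gamma>) (Lam c \<chi> t)) (elt \<Gamma> v)"
    by (simp add: z xv elt_insert[OF cLam])
  also have "\<dots> = elt \<Gamma> (Lam c \<chi> (t[a ::= v]))"
    using assms(3) v(2) by (simp add: subst_el_term_model[OF assms(1)] subst_Lam)
  also have "\<dots> = elt (insert (c, \<chi>) \<Gamma>) (Lam c \<chi> (t[a ::= v]))"
    by (simp add: elt_insert[OF cLam])
  also have "\<dots> = elt_abs c \<chi> (subst_el term_model a \<phi> z x)"
    using assms(1,3) unfolding z xv'
    by (subst insert_commute) (simp add: subst_el_term_model)
  finally show ?thesis .
qed

text \<open>Once all elements are presented over suitable environments,
  \<open>subst_el_term_model\<close> turns the substitution axioms into laws of syntactic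
  substitution.\<close>

lemma nominal_model_term_model: "nominal_model ctype (term_model :: ('b, 'c, ('b, 'c) raw_trm + 'j) interp)"
proof (unfold_locales, unfold term_model_simps)
  fix \<Gamma> \<Gamma>' :: "'b env" and \<phi> \<psi> :: "'b ty" and a and C :: 'c and \<pi>
    and x y z z' :: "('b, 'c, 'j) zterm"
  show "elt {(a, \<phi>)} (Var a) \<in> (term_carrier \<Gamma> :: ('b, 'c, 'j) zterm set)"
    if "is_env \<Gamma>" "(a, \<phi>) \<in> \<Gamma>"
  proof -
    have "beta_fv (Var a) \<subseteq> {a}" using beta_fv_subset[of "Var a"] by simp
    also have "\<dots> \<subseteq> Domain \<Gamma>" using that(2) by blast
    finally show ?thesis unfolding elt_Var[OF that] by (rule elt_in_term_carrier)
  qed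
  show "elt {} (Con C) \<in> (term_carrier \<Gamma> :: ('b, 'c, 'j) zterm set)"
    unfolding elt_Con[of C \<Gamma>]
    by (rule elt_in_term_carrier, rule order_trans[OF beta_fv_subset]) simp
  show "elt_abs a \<phi> x \<in> term_carrier \<Gamma>"
    if x: "x \<in> term_carrier (insert (a, \<phi>) \<Gamma>)"
  proof -
    obtain t where t: "x = elt (insert (a, \<phi>) \<Gamma>) t" "beta_fv t \<subseteq> Domain (insert (a, \<phi>) \<Gamma>)"
      using x by (rule term_carrierE)
    have "elt_abs a \<phi> x = elt \<Gamma> (Lam a \<phi> t)"
      unfolding t elt_abs_elt by (rule elt_insert) (use beta_fv_Lam in blast)
    moreover have "beta_fv (Lam a \<phi> t) \<subseteq> Domain \<Gamma>"
      using beta_fv_Lam[of a \<phi> t] t(2) by auto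
    ultimately show ?thesis by (simp add: elt_in_term_carrier)
  qed
  show "elt_app x y \<in> term_carrier \<Gamma>" if x: "x \<in> term_carrier \<Gamma>" and y: "y \<in> term_carrier \<Gamma>"
  proof -
    obtain t where t: "x = elt \<Gamma> t" "beta_fv t \<subseteq> Domain \<Gamma>" using x by (rule term_carrierE)
    obtain u where u: "y = elt \<Gamma> u" "beta_fv u \<subseteq> Domain \<Gamma>" using y by (rule term_carrierE)
    have "beta_fv (App t u) \<subseteq> Domain \<Gamma>"
      using t(2) u(2) beta_fv_App by blast
    then show ?thesis by (simp add: t(1) u(1) elt_in_term_carrier)
  qed
  show "supp zperm x \<subseteq> Domain \<Gamma>" if "x \<in> term_carrier \<Gamma>"
    using that by (rule term_carrierE) (simp add: supp_elt)
  show "zperm \<pi> (elt {(a, \<phi>)} (Var a) :: ('b, 'c, 'j) zterm) = elt {(\<pi> \<langle>$\<rangle> a, \<phi>)} (Var (\<pi> \<langle>$\<rangle> a))"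
    by (simp add: zperm_elt env_perm_def)
  show "zperm \<pi> (elt {} (Con C) :: ('b, 'c, 'j) zterm) = elt {} (Con C)"
    by (simp add: zperm_elt env_perm_def)
  show "zperm \<pi> (elt_abs a \<phi> x) = elt_abs (\<pi> \<langle>$\<rangle> a) \<phi> (zperm \<pi> x)"
    if "x \<in> term_carrier (insert (a, \<phi>) \<Gamma>)"
    using that by (rule term_carrierE) (simp add: zperm_elt)
  show "zperm \<pi> (elt_app x y) = elt_app (zperm \<pi> x) (zperm \<pi> y)"
    if x: "x \<in> term_carrier \<Gamma>" and y: "y \<in> term_carrier \<Gamma>"
  proof -
    obtain t where "x = elt \<Gamma> t" using x by (rule term_carrierE)
    moreover obtain u where "y = elt \<Gamma> u" using y by (rule term_carrierE)
    ultimately show ?thesis by (simp add: zperm_elt)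
  qed
  show "subst_el term_model a \<phi> (elt {(a, \<phi>)} (Var a)) x = x"
    if "is_env \<Gamma>" "a \<notin> Domain \<Gamma>" "x \<in> term_carrier \<Gamma>"
  proof -
    note Var = elt_Var[OF is_env_insert[OF that(1,2)] insertI1]
    show ?thesis
      unfolding Var using that(3)
      by (rule term_carrierE) (simp add: subst_el_term_model[OF that(2)] subst_Var)
  qed
  show "subst_el term_model a \<phi> z x = z"
    if a: "a \<notin> Domain \<Gamma>" and x: "x \<in> term_carrier \<Gamma>" and z: "z \<in> term_carrier (insert (a, \<phi>) \<Gamma>)"
      and fresh: "a \<notin> supp zperm z"
  proof -
    obtain t where t: "z = elt (insert (a, \<phi>) \<Gamma>) t"
      using z by (rule term_carrierE)
    obtain u where u: "x = elt \<Gamma> u"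
      using x by (rule term_carrierE)
    have "a \<notin> beta_fv t" using fresh by (simp add: t supp_elt)
    \<comment> \<open>Freshness for the element only says that some representative avoids
      \<open>a\<close>; on that one the substitution is vacuous.\<close>
    then obtain s where s: "s =\<^sub>\<beta> t" "a \<notin> fv s" by (rule not_in_beta_fvE)
    have zs: "z = elt (insert (a, \<phi>) \<Gamma>) s"
      unfolding t by (rule elt_cong[OF s(1), symmetric])
    have "a \<notin> beta_fv s" using s(2) beta_fv_subset by blast
    then show ?thesis
      unfolding zs u subst_el_term_model[OF a] using s(2) by (simp add: subst_fresh elt_insert)
  qed
  show "subst_el term_model a \<phi> (elt_app z' z) x
      = elt_app (subst_el term_model a \<phi> z' x) (subst_el term_model a \<phi> z x)"
    if a: "a \<notin> Domain \<Gamma>" and x: "x \<in> term_carrier \<Gamma>"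
      and z': "z' \<in> term_carrier (insert (a, \<phi>) \<Gamma>)" and z: "z \<in> term_carrier (insert (a, \<phi>) \<Gamma>)"
  proof -
    obtain t where t: "x = elt \<Gamma> t" using x by (rule term_carrierE)
    obtain u where u: "z' = elt (insert (a, \<phi>) \<Gamma>) u" using z' by (rule term_carrierE)
    obtain v where v: "z = elt (insert (a, \<phi>) \<Gamma>) v" using z by (rule term_carrierE)
    show ?thesis
      unfolding t u v by (simp add: subst_el_term_model[OF a] subst_App)
  qed
qed (assumption | rule finitely_supported_term_carrier term_carrier_Int term_carrier_perm term_model_sub_abs)+

section \<open>Interpretation in the term model and completeness\<close>

lemma denotes_term_model:
  "typing ctype \<Gamma> r \<phi> \<Longrightarrow> is_env \<Gamma> \<Longrightarrow> denotes term_model \<Gamma> r (elt \<Gamma> r)"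
proof (induction rule: typing.induct)
  case (typing_Var a \<phi> \<Gamma>)
  then show ?case
    using denotes_Var[OF typing_Var(1), of term_model] by (simp add: elt_Var)
next
  case (typing_Con C \<phi> \<Gamma>)
  then show ?case
    using denotes_Con[of term_model \<Gamma> C] by (simp add: elt_Con[of C \<Gamma>])
next
  case (typing_Lam a \<Gamma> \<phi> r \<psi>)
  have "a \<notin> beta_fv (Lam a \<phi> r)" using beta_fv_Lam by blast
  then show ?case
    using denotes_Lam[OF typing_Lam.hyps(1) typing_Lam.IH] typing_Lam by (simp add: is_env_insert elt_insert)
next
  case (typing_App \<Gamma> r \<phi> \<psi> s)
  then show ?case
    using denotes_App[of term_model \<Gamma> r "elt \<Gamma> r" s "elt \<Gamma> s"] by simp
qed

theorem theorem3p11: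
  fixes ctype :: "'c \<rightharpoonup> 'b ty"
    and \<Gamma> :: "'b env"
    and r s :: "('b, 'c) trm"
  assumes "is_env \<Gamma>"
    and "\<And>I :: ('b, 'c, ('b, 'c) raw_trm + 'j) interp. nominal_model ctype I \<Longrightarrow> valid ctype I \<Gamma> r s"
  shows "r =\<^sub>\<beta> s"
proof -
  let ?I = "term_model :: ('b, 'c, ('b, 'c) raw_trm + 'j) interp"
  interpret nominal_model ctype ?I by (rule nominal_model_term_model)
  have "valid ctype ?I \<Gamma> r s" by (rule assms(2)) (rule nominal_model_term_model)
  then obtain \<phi> where r: "typing ctype \<Gamma> r \<phi>" and s: "typing ctype \<Gamma> s \<phi>"
    and eq: "interp ?I \<Gamma> r = interp ?I \<Gamma> s"
    by (auto simp: valid_def)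
  have "interp ?I \<Gamma> t = elt \<Gamma> t" if "typing ctype \<Gamma> t \<phi>" for t
    unfolding denotes_iff[OF assms(1) that, symmetric] by (rule denotes_term_model[OF that assms(1)])
  with eq r s have "elt \<Gamma> r = (elt \<Gamma> s :: ('b, 'c, 'j) zterm)" by simp
  \<comment> \<open>Equal elements have equal class components, which is the desired
    \<open>=\<^sub>\<beta>\<close>.\<close>
  then show ?thesis by (simp add: elt_eq_iff)
qed

end
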